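(* Let $\mathcal{H}$ be a complex separable infinite-dimensional Hilbert space with a fixed orthonormal basis $\{e_n\}_{n=1}^\infty$, and let $\psi=\{f_n\}_{n=1}^\infty$ be a Schauder basis of $\mathcal{H}$ whose Schauder matrix $M_\psi$ with respect to $\{e_n\}$ represents a bounded operator on $\mathcal{H}$. Then the orbit $$O_{gl}(M_\psi)=\{XM_\psi : X \text{ is the matrix with respect to } \{e_n\} \text{ of an invertible bounded operator on } \mathcal{H}\}$$ contains matrices of strongly irreducible operators.
   Context: A sequence $\{f_n\}_{n=1}^\infty$ in $\mathcal{H}$ is a Schauder basis if for every $x\in\mathcal{H}$ there is a unique sequence $\{\alpha_n\}$ of complex numbers such that $\sum_{n=1}^k\alpha_nf_n\to x$ in norm as $k\to\infty$. If $f_n=\sum_{k=1}^\infty f_{kn}e_k$, the Schauder matrix of $\psi=\{f_n\}$ with respect to the orthonormal basis $\{e_n\}$ is $M_\psi=(f_{kn})_{k,n\ge1}$, i.e. its $n$-th column is the coordinate sequence of $f_n$. It represents a bounded operator if there is a bounded operator $T_\psi$ on $\mathcal{H}$ with $T_\psi e_n=f_n$ for all $n$. A bounded operator $A$ on $\mathcal{H}$ is strongly irreducible if no bounded idempotent operator other than $0$ and $I$ commutes with $A$. *)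

theory Defs
  imports "HOL-Analysis.Analysis"
begin

section \<open>Complex Hilbert spaces\<close>

class complex_vector = real_vector +
  fixes scaleC :: "complex \<Rightarrow> 'a \<Rightarrow> 'a" (infixr "*\<^sub>C" 75)
  assumes scaleC_add_right: "a *\<^sub>C (x + y) = a *\<^sub>C x + a *\<^sub>C y"
    and scaleC_add_left: "(a + b) *\<^sub>C x = a *\<^sub>C x + b *\<^sub>C x"
    and scaleC_scaleC: "a *\<^sub>C (b *\<^sub>C x) = (a * b) *\<^sub>C x"
    and scaleC_of_real: "complex_of_real r *\<^sub>C x = r *\<^sub>R x"

global_interpretation complex_vector:
  vector_space "scaleC :: complex \<Rightarrow> 'a \<Rightarrow> 'a::complex_vector"
  defines cspan = complex_vector.span
proof unfold_locales
  fix x :: 'a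
  show "1 *\<^sub>C x = x" using scaleC_of_real[of 1 x] by simp
qed (simp_all add: scaleC_add_right scaleC_add_left scaleC_scaleC)

text \<open>The inner product is antilinear in its first argument. Positive definiteness is
  part of \<open>cinner_self\<close>, since the norm is positive definite.\<close>

class complex_inner = complex_vector + real_normed_vector +
  fixes cinner :: "'a \<Rightarrow> 'a \<Rightarrow> complex"
  assumes cinner_commute: "cinner x y = cnj (cinner y x)"
    and cinner_add_right: "cinner x (y + z) = cinner x y + cinner x z"
    and cinner_scaleC_right: "cinner x (c *\<^sub>C y) = c * cinner x y"
    and cinner_self: "cinner x x = complex_of_real ((norm x)\<^sup>2)"

class chilbert_space = complex_inner + complete_space

section \<open>Bounded operators\<close>

definition bounded_clinear :: "('a::complex_inner \<Rightarrow> 'a) \<Rightarrow> bool" where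
  "bounded_clinear A \<longleftrightarrow> bounded_linear A \<and> (\<forall>c x. A (c *\<^sub>C x) = c *\<^sub>C A x)"

definition invertible_bounded :: "('a::complex_inner \<Rightarrow> 'a) \<Rightarrow> bool" where
  "invertible_bounded X \<longleftrightarrow>
     bounded_clinear X \<and> (\<exists>Y. bounded_clinear Y \<and> X \<circ> Y = id \<and> Y \<circ> X = id)"

definition strongly_irreducible :: "('a::complex_inner \<Rightarrow> 'a) \<Rightarrow> bool" where
  "strongly_irreducible A \<longleftrightarrow> bounded_clinear A \<and>
     (\<forall>P. bounded_clinear P \<and> P \<circ> P = P \<and> P \<circ> A = A \<circ> P \<longrightarrow> P = (\<lambda>x. 0) \<or> P = id)"

section \<open>Bases and matrices\<close>

text \<open>All sequences and matrices are indexed from 0. A space carrying an orthonormal basis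
  indexed by the naturals is automatically separable and infinite-dimensional.\<close>

definition orthonormal_basis :: "(nat \<Rightarrow> 'a::complex_inner) \<Rightarrow> bool" where
  "orthonormal_basis e \<longleftrightarrow>
     (\<forall>i j. cinner (e i) (e j) = (if i = j then 1 else 0)) \<and> closure (cspan (range e)) = UNIV"

definition schauder_basis :: "(nat \<Rightarrow> 'a::complex_inner) \<Rightarrow> bool" where
  "schauder_basis f \<longleftrightarrow> (\<forall>x. \<exists>!\<alpha>. (\<lambda>n. \<alpha> n *\<^sub>C f n) sums x)"

text \<open>Entry (k, n) is the coefficient of e k in the expansion of f n; see
  \<open>schauder_matrix_sums\<close> below.\<close>

definition schauder_matrix ::
    "(nat \<Rightarrow> 'a::complex_inner) \<Rightarrow> (nat \<Rightarrow> 'a) \<Rightarrow> nat \<Rightarrow> nat \<Rightarrow> complex" where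
  "schauder_matrix e f = (\<lambda>k n. cinner (e k) (f n))"

definition operator_matrix ::
    "(nat \<Rightarrow> 'a::complex_inner) \<Rightarrow> ('a \<Rightarrow> 'a) \<Rightarrow> nat \<Rightarrow> nat \<Rightarrow> complex" where
  "operator_matrix e A = (\<lambda>k n. cinner (e k) (A (e n)))"

definition represents_bounded_operator ::
    "(nat \<Rightarrow> 'a::complex_inner) \<Rightarrow> (nat \<Rightarrow> 'a) \<Rightarrow> bool" where
  "represents_bounded_operator e f \<longleftrightarrow> (\<exists>T. bounded_clinear T \<and> (\<forall>n. T (e n) = f n))"

text \<open>The series converges absolutely whenever the rows of the left factor and the columns of
  the right factor are square-summable. This holds for matrices of bounded operators and for
  Schauder matrices, so the default value of \<^term>\<open>suminf\<close> plays no role in \<open>gl_orbit\<close>.\<close>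

definition matrix_product ::
    "(nat \<Rightarrow> nat \<Rightarrow> complex) \<Rightarrow> (nat \<Rightarrow> nat \<Rightarrow> complex) \<Rightarrow> nat \<Rightarrow> nat \<Rightarrow> complex" where
  "matrix_product X M = (\<lambda>k n. \<Sum>j. X k j * M j n)"

definition gl_orbit ::
    "(nat \<Rightarrow> 'a::complex_inner) \<Rightarrow> (nat \<Rightarrow> nat \<Rightarrow> complex) \<Rightarrow> (nat \<Rightarrow> nat \<Rightarrow> complex) set" where
  "gl_orbit e M = {matrix_product (operator_matrix e X) M |X. invertible_bounded X}"

section \<open>The expansion defining the Schauder matrix\<close>

lemma cinner_zero_right [simp]: "cinner x 0 = 0"
  using cinner_add_right[of x 0 0] by simp

lemma cinner_add_left: "cinner (x + y) z = cinner x z + cinner y z"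
  by (metis cinner_add_right cinner_commute complex_cnj_add)

lemma cinner_sum_right: "cinner x (sum g S) = (\<Sum>i\<in>S. cinner x (g i))"
  by (induction S rule: infinite_finite_induct) (auto simp: cinner_add_right)

lemma cinner_diff_right: "cinner x (y - z) = cinner x y - cinner x z"
  by (metis add_diff_cancel_right' cinner_add_right diff_add_cancel)

lemma cinner_orth_commute: "cinner x y = 0 \<Longrightarrow> cinner y x = 0"
  by (metis cinner_commute complex_cnj_zero)

lemma norm_add_orth:
  fixes x y :: "'a::complex_inner"
  assumes "cinner x y = 0"
  shows "(norm (x + y))\<^sup>2 = (norm x)\<^sup>2 + (norm y)\<^sup>2"
proof -
  have "cinner (x + y) (x + y) = cinner x x + cinner y y"
    using assms cinner_orth_commute[OF assms] by (simp add: cinner_add_left cinner_add_right)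
  then have "complex_of_real ((norm (x + y))\<^sup>2) = complex_of_real ((norm x)\<^sup>2 + (norm y)\<^sup>2)"
    by (simp add: cinner_self)
  then show ?thesis by (simp only: of_real_eq_iff)
qed

lemma orthonormal_basis_expansion:
  fixes e :: "nat \<Rightarrow> 'a::complex_inner"
  assumes "orthonormal_basis e"
  shows "(\<lambda>k. cinner (e k) x *\<^sub>C e k) sums x"
proof -
  define P where "P N y = (\<Sum>k<N. cinner (e k) y *\<^sub>C e k)" for N y
  have orth: "cinner (e i) (e j) = (if i = j then 1 else 0)" for i j
    using assms by (simp add: orthonormal_basis_def)
  have dense: "closure (cspan (range e)) = UNIV"
    using assms by (simp add: orthonormal_basis_def)
  have P_add: "P N (y + z) = P N y + P N z" for N y z
    by (simp add: P_def cinner_add_right scaleC_add_left sum.distrib)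
  have P_scale: "P N (c *\<^sub>C y) = c *\<^sub>C P N y" for N c y
    by (simp add: P_def cinner_scaleC_right complex_vector.scale_sum_right scaleC_scaleC)
  have P_basis: "P N (e n) = e n" if "n < N" for N n
  proof -
    have "P N (e n) = (\<Sum>k<N. if k = n then e n else 0)"
      unfolding P_def by (rule sum.cong) (auto simp: orth)
    then show ?thesis using that by simp
  qed
  have coeff: "cinner (e k) (P N y) = cinner (e k) y" if "k < N" for k N y
  proof -
    have "cinner (e k) (P N y) = (\<Sum>j<N. if j = k then cinner (e k) y else 0)"
      unfolding P_def cinner_sum_right by (rule sum.cong) (auto simp: orth cinner_scaleC_right)
    then show ?thesis using that by simp
  qed
  have Bessel: "norm (P N y) \<le> norm y" for N y
  proof -
    have "cinner (y - P N y) (e k) = 0" if "k < N" for k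
      by (rule cinner_orth_commute) (simp add: cinner_diff_right coeff that)
    then have "cinner (y - P N y) (P N y) = 0"
      by (subst (2) P_def) (simp add: cinner_sum_right cinner_scaleC_right)
    from norm_add_orth[OF this] have "(norm (P N y))\<^sup>2 \<le> (norm y)\<^sup>2" by simp
    then show ?thesis by (rule power2_le_imp_le) simp
  qed
  have fin: "\<exists>N0. \<forall>N\<ge>N0. P N y = y" if "y \<in> cspan (range e)" for y
    using that
  proof (induction rule: complex_vector.span_induct_alt)
    case base
    show ?case by (simp add: P_def)
  next
    case (step c b y)
    then obtain n N1 where "b = e n" "\<forall>N\<ge>N1. P N y = y" by auto
    then have "\<forall>N\<ge>max N1 (Suc n). P N (c *\<^sub>C b + y) = c *\<^sub>C b + y"
      by (simp add: P_add P_scale P_basis)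
    then show ?case by blast
  qed
  have "(\<lambda>N. P N x) \<longlonglongrightarrow> x"
  proof (rule LIMSEQ_I)
    fix r :: real assume "0 < r"
    have "x \<in> closure (cspan (range e))" using dense by simp
    then obtain y where y: "y \<in> cspan (range e)" "dist y x < r / 2"
      using \<open>0 < r\<close> unfolding closure_approachable by (meson half_gt_zero)
    obtain N0 where N0: "\<forall>N\<ge>N0. P N y = y" using fin[OF y(1)] by blast
    have "norm (P N x - x) < r" if "N \<ge> N0" for N
    proof -
      have "P N x - x = P N (x - y) + (y - x)"
        using P_add[of N "x - y" y] N0 that by simp
      then have "norm (P N x - x) \<le> norm (P N (x - y)) + norm (y - x)"
        using norm_triangle_ineq[of "P N (x - y)" "y - x"] by metis
      also have "\<dots> \<le> norm (x - y) + norm (y - x)" using Bessel by simp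
      also have "\<dots> < r" using y(2) by (simp add: dist_norm norm_minus_commute)
      finally show ?thesis .
    qed
    then show "\<exists>N0. \<forall>N\<ge>N0. norm (P N x - x) < r" by blast
  qed
  then show ?thesis by (simp add: sums_def P_def)
qed

lemma schauder_matrix_sums:
  "orthonormal_basis e \<Longrightarrow> (\<lambda>k. schauder_matrix e f k n *\<^sub>C e k) sums f n"
  by (simp add: schauder_matrix_def orthonormal_basis_expansion)

end

theory Submission
  imports Defs
begin

text \<open>The operator \<open>T\<close> with \<open>T e\<^sub>n = \<psi>\<^sub>n\<close> is injective with dense range. If \<open>T\<close> is bounded below, it is invertible and any invertible strongly irreducible
  operator will do. Otherwise cut the spectrum of \<open>T\<^sup>* T\<close> into dyadic pieces: there are an orthonormal
  basis \<open>v\<close>, an invertible \<open>Y\<close> and weights \<open>w\<^sub>k\<close> with infimum 0 such that \<open>T v\<^sub>k = w\<^sub>k Y v\<^sub>k\<close>. Index \<open>v\<close>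
  by the integers and let \<open>B\<close> be the bilateral shift along \<open>v\<close>. Then \<open>B Y\<^sup>-\<^sup>1 T\<close> is an injective bilateral
  weighted shift that is not invertible, its commutant embeds into the formal power series, and that
  ring has no idempotents except 0 and 1.\<close>

text \<open>Only left multiplication by an invertible operator is allowed, so \<open>T\<close>
  cannot be conjugated into a convenient form. Strong irreducibility does not refer to a basis,
  however, so \<open>X T\<close> may be studied along any orthonormal basis. The shift is bilateral
  because a unilateral one is not invertible and could not be a factor of \<open>X\<close>. The case
  distinction has a reason: the unweighted bilateral shift is invertible and commutes with many
  spectral projections; weights close to 0 are what excludes such idempotents. The dyadic cutting is
  forced by the possible continuous spectrum of \<open>T\<^sup>* T\<close>, which prevents an honest
  diagonalization: replacing the spectrum in one piece by a single value changes \<open>T\<close> by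
  a factor bounded above and below, and \<open>Y\<close> collects these factors. The projections
  come from two explicit iterations, one for an absolute value and one for a kernel
  projection.\<close>

instance chilbert_space \<subseteq> banach ..

section \<open>Inner product and operator basics\<close>

lemma cinner_scaleC_left: "cinner (c *\<^sub>C x) y = cnj c * cinner x y"
  by (metis cinner_commute cinner_scaleC_right complex_cnj_mult)

lemma cinner_zero_left [simp]: "cinner 0 x = 0"
  using cinner_add_left[of 0 0 x] by simp

lemma cinner_diff_left: "cinner (x - y) z = cinner x z - cinner y z"
  by (metis add_diff_cancel_right' cinner_add_left diff_add_cancel)

lemma cinner_scaleR_right: "cinner x (r *\<^sub>R y) = of_real r * cinner x y"
  by (metis cinner_scaleC_right scaleC_of_real)

lemma cinner_scaleR_left: "cinner (r *\<^sub>R x) y = of_real r * cinner x y"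
  by (metis cinner_scaleC_left scaleC_of_real complex_cnj_complex_of_real)

lemma norm_sq_cinner: "(norm x)\<^sup>2 = Re (cinner x x)"
  by (simp add: cinner_self)

lemma norm_scaleC: "norm (c *\<^sub>C x) = cmod c * norm x" for x :: "'a::complex_inner"
proof -
  have "cinner (c *\<^sub>C x) (c *\<^sub>C x) = complex_of_real ((cmod c * norm x)\<^sup>2)"
    by (simp add: cinner_scaleC_left cinner_scaleC_right cinner_self[of x] power_mult_distrib
        complex_norm_square[symmetric])
  then have "(norm (c *\<^sub>C x))\<^sup>2 = (cmod c * norm x)\<^sup>2"
    by (simp only: cinner_self of_real_eq_iff)
  then show ?thesis by (rule power2_eq_imp_eq) auto
qed

lemma norm_eq_1I:
  assumes "cinner x x = 1" shows "norm x = 1"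
proof -
  have "(norm x)\<^sup>2 = 1\<^sup>2" using assms by (simp add: norm_sq_cinner)
  then show ?thesis by (rule power2_eq_imp_eq) auto
qed

lemma Cauchy_Schwarz_cinner: "cmod (cinner x y) \<le> norm x * norm y"
proof (cases "x = 0")
  case False
  define c where "c = cinner x y / of_real ((norm x)\<^sup>2)"
  have "cinner x (y - c *\<^sub>C x) = 0"
    using False by (simp add: cinner_diff_right cinner_scaleC_right c_def cinner_self)
  then have "cinner (c *\<^sub>C x) (y - c *\<^sub>C x) = 0"
    by (simp add: cinner_scaleC_left)
  from norm_add_orth[OF this] have "(norm (c *\<^sub>C x))\<^sup>2 \<le> (norm y)\<^sup>2" by simp
  then have "norm (c *\<^sub>C x) \<le> norm y" by (rule power2_le_imp_le) simp
  then have "cmod (cinner x y) / norm x \<le> norm y"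
    using False by (simp add: norm_scaleC c_def norm_divide power2_eq_square norm_mult)
  then show ?thesis using False by (simp add: field_simps)
qed simp

lemma bounded_linear_cinner_right: "bounded_linear (cinner x)"
  by (rule bounded_linear_intro[where K = "norm x"])
    (auto simp: cinner_add_right cinner_scaleR_right scaleR_conv_of_real
      intro: order_trans[OF Cauchy_Schwarz_cinner] simp: mult.commute)

lemma tendsto_cinner_right: "(f \<longlongrightarrow> l) F \<Longrightarrow> ((\<lambda>n. cinner x (f n)) \<longlongrightarrow> cinner x l) F"
  by (rule bounded_linear.tendsto[OF bounded_linear_cinner_right])

lemma tendsto_cinner_left: "(f \<longlongrightarrow> l) F \<Longrightarrow> ((\<lambda>n. cinner (f n) x) \<longlongrightarrow> cinner l x) F"
  using tendsto_cnj[OF tendsto_cinner_right[of f l F x]] by (simp flip: cinner_commute)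

lemma bounded_linear_scaleC: "bounded_linear (\<lambda>x::'a::complex_inner. c *\<^sub>C x)"
  by (rule bounded_linear_intro[where K = "cmod c"])
    (auto simp: scaleC_add_right norm_scaleC mult.commute scaleC_scaleC simp flip: scaleC_of_real)

lemma tendsto_scaleC: "(f \<longlongrightarrow> l) F \<Longrightarrow> ((\<lambda>n. c *\<^sub>C f n) \<longlongrightarrow> c *\<^sub>C l) F"
  for f :: "'b \<Rightarrow> 'a::complex_inner"
  by (rule bounded_linear.tendsto[OF bounded_linear_scaleC])

lemma norm_diff_sq: "(norm (x - y))\<^sup>2 = (norm x)\<^sup>2 - 2 * Re (cinner x y) + (norm y)\<^sup>2"
  for x y :: "'a::complex_inner"
proof -
  have "Re (cinner y x) = Re (cinner x y)" by (subst cinner_commute) simp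
  then show ?thesis by (simp add: norm_sq_cinner cinner_diff_left cinner_diff_right)
qed

lemma bounded_clinearI:
  assumes "\<And>x y. A (x + y) = A x + A y" and "\<And>c x. A (c *\<^sub>C x) = c *\<^sub>C A x"
    and "\<And>x. norm (A x) \<le> K * norm x"
  shows "bounded_clinear A"
  unfolding bounded_clinear_def
proof
  show "bounded_linear A"
    by (rule bounded_linear_intro[where K = K])
      (use assms in \<open>auto simp: mult.commute simp flip: scaleC_of_real\<close>)
qed (use assms in auto)

lemma bounded_clinearD:
  assumes "bounded_clinear A"
  shows "bounded_linear A" "A (c *\<^sub>C x) = c *\<^sub>C A x" "A (x + y) = A x + A y"
    "A (x - y) = A x - A y" "A 0 = 0" "A (r *\<^sub>R x) = r *\<^sub>R A x"
  using assms linear_simps unfolding bounded_clinear_def by blast+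

lemma bounded_clinear_id: "bounded_clinear (\<lambda>x. x)"
  by (simp add: bounded_clinear_def)

lemma bounded_clinear_compose:
  "bounded_clinear A \<Longrightarrow> bounded_clinear B \<Longrightarrow> bounded_clinear (\<lambda>x. A (B x))"
  by (simp add: bounded_clinear_def bounded_linear_compose)

lemma bounded_clinear_add:
  "bounded_clinear A \<Longrightarrow> bounded_clinear B \<Longrightarrow> bounded_clinear (\<lambda>x. A x + B x)"
  by (simp add: bounded_clinear_def bounded_linear_add scaleC_add_right)

lemma bounded_clinear_diff:
  "bounded_clinear A \<Longrightarrow> bounded_clinear B \<Longrightarrow> bounded_clinear (\<lambda>x. A x - B x)"
  by (simp add: bounded_clinear_def bounded_linear_sub complex_vector.scale_right_diff_distrib)

lemma bounded_clinear_scaleR: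
  assumes "bounded_clinear A" shows "bounded_clinear (\<lambda>x. r *\<^sub>R A x)"
proof -
  have "bounded_linear (\<lambda>x. r *\<^sub>R A x)"
    using assms bounded_linear_compose[OF bounded_linear_scaleR_right] bounded_clinear_def by blast
  then show ?thesis
    using assms unfolding bounded_clinear_def
    by (simp add: scaleC_scaleC mult.commute flip: scaleC_of_real)
qed

lemma bounded_clinear_tendsto:
  "bounded_clinear A \<Longrightarrow> (f \<longlongrightarrow> l) F \<Longrightarrow> ((\<lambda>n. A (f n)) \<longlongrightarrow> A l) F"
  using bounded_linear.tendsto bounded_clinearD(1) by fast

lemma bounded_clinear_bound:
  assumes "bounded_clinear A" obtains K where "K > 0" "\<And>x. norm (A x) \<le> K * norm x"
  using assms unfolding bounded_clinear_def
  by (metis bounded_linear.pos_bounded mult.commute)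

section \<open>Lower bounds and invertibility\<close>

lemma bounded_below_dense_imp_surj:
  fixes A :: "'a::chilbert_space \<Rightarrow> 'a"
  assumes "bounded_clinear A" "c > 0" "\<And>x. c * norm x \<le> norm (A x)"
    and dense: "closure (range A) = UNIV"
  shows "surj A"
proof -
  have "y \<in> range A" for y
  proof -
    have "y \<in> closure (range A)" using dense by simp
    then obtain z where z: "\<And>n. z n \<in> range A" "z \<longlonglongrightarrow> y"
      unfolding closure_sequential by blast
    have "\<forall>n. \<exists>x. z n = A x" using z(1) by auto
    then obtain x where x: "\<And>n. z n = A (x n)" by (auto dest: choice)
    \<comment> \<open>The lower bound on \<open>A\<close> turns a convergent sequence of images into
      a Cauchy sequence of preimages, so the range is closed.\<close>
    have "Cauchy x"
    proof (rule metric_CauchyI)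
      fix \<epsilon> :: real assume "\<epsilon> > 0"
      have "Cauchy z" using z(2) by (rule LIMSEQ_imp_Cauchy)
      then obtain M where M: "\<And>m n. m \<ge> M \<Longrightarrow> n \<ge> M \<Longrightarrow> dist (z m) (z n) < c * \<epsilon>"
        using \<open>\<epsilon> > 0\<close> \<open>c > 0\<close> by (meson metric_CauchyD mult_pos_pos)
      have "dist (x m) (x n) < \<epsilon>" if "m \<ge> M" "n \<ge> M" for m n
      proof -
        have "c * dist (x m) (x n) \<le> dist (z m) (z n)"
          using assms(3)[of "x m - x n"] by (simp add: dist_norm x bounded_clinearD(4)[OF assms(1)])
        also have "\<dots> < c * \<epsilon>" using M that by blast
        finally show ?thesis using \<open>c > 0\<close> by simp
      qed
      then show "\<exists>M. \<forall>m\<ge>M. \<forall>n\<ge>M. dist (x m) (x n) < \<epsilon>" by blast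
    qed
    then obtain l where "x \<longlonglongrightarrow> l" using Cauchy_convergent_iff convergent_def by blast
    then have "(\<lambda>n. A (x n)) \<longlonglongrightarrow> A l" by (rule bounded_clinear_tendsto[OF assms(1)])
    then have "z \<longlonglongrightarrow> A l" by (simp flip: x)
    then show ?thesis using z(2) LIMSEQ_unique by blast
  qed
  then show ?thesis by blast
qed

lemma invertible_boundedI:
  assumes A: "bounded_clinear A" and c: "c > 0" and lower: "\<And>x. c * norm x \<le> norm (A x)"
    and "surj A"
  shows "invertible_bounded A"
proof -
  have inj: "inj A"
  proof (rule injI)
    fix x y assume "A x = A y"
    then have "c * norm (x - y) \<le> 0" using lower[of "x - y"] by (simp add: bounded_clinearD[OF A])
    then show "x = y" using c by (simp add: mult_le_0_iff)
  qed
  have AY: "A (inv A y) = y" for y using \<open>surj A\<close> by (simp add: surj_f_inv_f)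
  have YA: "inv A (A x) = x" for x using inj by simp
  have "bounded_clinear (inv A)"
  proof (rule bounded_clinearI[where K = "1 / c"])
    fix x y show "inv A (x + y) = inv A x + inv A y"
      by (metis AY YA bounded_clinearD(3)[OF A])
  next
    fix a x show "inv A (a *\<^sub>C x) = a *\<^sub>C inv A x"
      by (metis AY YA bounded_clinearD(2)[OF A])
  next
    fix x show "norm (inv A x) \<le> 1 / c * norm x"
      using lower[of "inv A x"] c by (simp add: AY field_simps)
  qed
  then show ?thesis unfolding invertible_bounded_def using A AY YA
    by (intro conjI exI[of _ "inv A"]) auto
qed

lemma invertible_bounded_compose:
  assumes "invertible_bounded A" "invertible_bounded B"
  shows "invertible_bounded (\<lambda>x. A (B x))"
proof -
  obtain A' B' where "bounded_clinear A'" "A \<circ> A' = id" "A' \<circ> A = id"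
    "bounded_clinear B'" "B \<circ> B' = id" "B' \<circ> B = id"
    using assms unfolding invertible_bounded_def by blast
  then show ?thesis using assms unfolding invertible_bounded_def
    by (intro conjI exI[of _ "\<lambda>x. B' (A' x)"])
      (auto simp: fun_eq_iff intro: bounded_clinear_compose)
qed

section \<open>Orthogonal series and orthonormal bases\<close>

lemma norm_sum_orth:
  fixes v :: "'i \<Rightarrow> 'a::complex_inner"
  assumes "finite S" "\<And>i j. i \<in> S \<Longrightarrow> j \<in> S \<Longrightarrow> i \<noteq> j \<Longrightarrow> cinner (v i) (v j) = 0"
  shows "(norm (sum v S))\<^sup>2 = (\<Sum>i\<in>S. (norm (v i))\<^sup>2)"
  using assms
proof (induction S)
  case (insert a S)
  have "cinner (v a) (sum v S) = 0"
    unfolding cinner_sum_right using insert by (intro sum.neutral) auto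
  then show ?case using insert by (simp add: norm_add_orth)
qed simp

text \<open>Pythagoras identifies the squared norm of a block of the series with the same block of
  the series of squared norms, so one Cauchy criterion yields the other.\<close>

lemma orthogonal_summable:
  fixes v :: "nat \<Rightarrow> 'a::chilbert_space"
  assumes orth: "\<And>i j. i \<noteq> j \<Longrightarrow> cinner (v i) (v j) = 0" and "summable (\<lambda>n. (norm (v n))\<^sup>2)"
  shows "summable v" "(norm (suminf v))\<^sup>2 = (\<Sum>n. (norm (v n))\<^sup>2)"
proof -
  show s: "summable v"
    unfolding summable_Cauchy
  proof (intro allI impI)
    fix \<epsilon> :: real assume "\<epsilon> > 0"
    then obtain N where N: "\<And>m n. m \<ge> N \<Longrightarrow> norm (\<Sum>k=m..<n. (norm (v k))\<^sup>2) < \<epsilon>\<^sup>2"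
      using assms(2) unfolding summable_Cauchy by (meson zero_less_power)
    have "norm (sum v {m..<n}) < \<epsilon>" if "m \<ge> N" for m n
    proof -
      have "(norm (sum v {m..<n}))\<^sup>2 < \<epsilon>\<^sup>2"
        using N[OF that, of n] by (subst norm_sum_orth) (auto simp: orth sum_nonneg)
      then show ?thesis using \<open>\<epsilon> > 0\<close> power2_less_imp_less by fastforce
    qed
    then show "\<exists>N. \<forall>m\<ge>N. \<forall>n. norm (sum v {m..<n}) < \<epsilon>" by blast
  qed
  have "(\<lambda>n. (norm (\<Sum>k<n. v k))\<^sup>2) \<longlonglongrightarrow> (norm (suminf v))\<^sup>2"
    by (intro tendsto_intros summable_LIMSEQ s)
  moreover have "(norm (\<Sum>k<n. v k))\<^sup>2 = (\<Sum>k<n. (norm (v k))\<^sup>2)" for n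
    by (rule norm_sum_orth) (auto simp: orth)
  ultimately show "(norm (suminf v))\<^sup>2 = (\<Sum>n. (norm (v n))\<^sup>2)"
    using summable_LIMSEQ[OF assms(2)] LIMSEQ_unique by fastforce
qed

lemma Bessel_inequality:
  fixes u :: "'i \<Rightarrow> 'a::complex_inner"
  assumes "finite S" and orth: "\<And>i j. i \<in> S \<Longrightarrow> j \<in> S \<Longrightarrow> cinner (u i) (u j) = (if i = j then 1 else 0)"
  shows "(\<Sum>i\<in>S. (cmod (cinner (u i) x))\<^sup>2) \<le> (norm x)\<^sup>2"
proof -
  define p where "p = (\<Sum>i\<in>S. cinner (u i) x *\<^sub>C u i)"
  have nu: "norm (u i) = 1" if "i \<in> S" for i
    using orth[OF that that] by (simp add: norm_eq_1I)
  have "cinner (u i) p = cinner (u i) x" if "i \<in> S" for i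
  proof -
    have "cinner (u i) p = (\<Sum>j\<in>S. if j = i then cinner (u i) x else 0)"
      unfolding p_def cinner_sum_right using that
      by (intro sum.cong) (auto simp: cinner_scaleC_right orth)
    then show ?thesis using that assms(1) by simp
  qed
  then have "cinner (x - p) (u i) = 0" if "i \<in> S" for i
    using that by (metis cinner_diff_right cinner_orth_commute diff_self)
  then have "cinner (x - p) p = 0"
    by (subst (2) p_def) (simp add: cinner_sum_right cinner_scaleC_right)
  from norm_add_orth[OF this] have "(norm p)\<^sup>2 \<le> (norm x)\<^sup>2" by simp
  moreover have "(norm p)\<^sup>2 = (\<Sum>i\<in>S. (norm (cinner (u i) x *\<^sub>C u i))\<^sup>2)"
    unfolding p_def using assms(1)
    by (rule norm_sum_orth) (auto simp: cinner_scaleC_left cinner_scaleC_right orth)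
  ultimately show ?thesis by (simp add: norm_scaleC nu)
qed

text \<open>The Riesz-Fischer construction. The coefficients are controlled through finite sums
  because Bessel's inequality delivers them in that form, with a constant that then bounds the whole
  series.\<close>

lemma orthonormal_summable:
  fixes u :: "nat \<Rightarrow> 'a::chilbert_space"
  assumes orth: "\<And>i j. cinner (u i) (u j) = (if i = j then 1 else 0)"
    and bd: "\<And>n. (\<Sum>k<n. (cmod (c k))\<^sup>2) \<le> K"
  shows "summable (\<lambda>k. c k *\<^sub>C u k)" "(norm (\<Sum>k. c k *\<^sub>C u k))\<^sup>2 \<le> K"
    "cinner (u i) (\<Sum>k. c k *\<^sub>C u k) = c i"
proof -
  have nu: "norm (u i) = 1" for i by (simp add: norm_eq_1I orth)
  have sq: "summable (\<lambda>k. (cmod (c k))\<^sup>2)"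
    by (rule bounded_imp_summable[of _ K]) (simp_all only: lessThan_Suc_atMost[symmetric] bd zero_le_power2)
  have o: "cinner (c i *\<^sub>C u i) (c j *\<^sub>C u j) = 0" if "i \<noteq> j" for i j
    using that by (simp add: cinner_scaleC_left cinner_scaleC_right orth)
  have sq': "summable (\<lambda>k. (norm (c k *\<^sub>C u k))\<^sup>2)" using sq by (simp add: norm_scaleC nu)
  note * = orthogonal_summable[where v = "\<lambda>k. c k *\<^sub>C u k", OF o sq']
  show s: "summable (\<lambda>k. c k *\<^sub>C u k)" by (rule *(1))
  show "(norm (\<Sum>k. c k *\<^sub>C u k))\<^sup>2 \<le> K"
    using suminf_le_const[OF sq', of K] by (simp add: *(2) norm_scaleC nu bd)
  have "cinner (u i) (\<Sum>k. c k *\<^sub>C u k) = (\<Sum>k. cinner (u i) (c k *\<^sub>C u k))"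
    by (rule bounded_linear.suminf[OF bounded_linear_cinner_right s])
  also have "\<dots> = (\<Sum>k. if k = i then c i else 0)"
    by (intro suminf_cong) (auto simp: cinner_scaleC_right orth)
  also have "\<dots> = c i" by (rule sums_unique[symmetric, OF sums_single])
  finally show "cinner (u i) (\<Sum>k. c k *\<^sub>C u k) = c i" .
qed

lemma orthonormal_basisD: "orthonormal_basis e \<Longrightarrow> cinner (e i) (e j) = (if i = j then 1 else 0)"
  by (simp add: orthonormal_basis_def)

lemma orthonormal_basis_zeroI:
  assumes "orthonormal_basis e" "\<And>k. cinner (e k) x = 0" shows "x = 0"
  using orthonormal_basis_expansion[OF assms(1), of x] assms(2) by (simp add: sums_0 sums_unique2)

text \<open>A trivial orthogonal complement is what a maximality argument delivers. The Fourier
  series of \<open>x\<close> converges by Bessel, and \<open>x\<close> minus its sum is orthogonal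
  to every \<open>u k\<close>.\<close>

lemma orthonormal_basisI:
  fixes u :: "nat \<Rightarrow> 'a::chilbert_space"
  assumes orth: "\<And>i j. cinner (u i) (u j) = (if i = j then 1 else 0)"
    and total: "\<And>x. (\<And>k. cinner (u k) x = 0) \<Longrightarrow> x = 0"
  shows "orthonormal_basis u"
  unfolding orthonormal_basis_def
proof (intro conjI allI)
  have "x \<in> closure (cspan (range u))" for x
  proof -
    have bd: "(\<Sum>k<n. (cmod (cinner (u k) x))\<^sup>2) \<le> (norm x)\<^sup>2" for n
      by (rule Bessel_inequality) (auto simp: orth)
    note * = orthonormal_summable[where u = u, OF orth bd]
    have "x - (\<Sum>k. cinner (u k) x *\<^sub>C u k) = 0"
      by (rule total) (simp add: cinner_diff_right *(3))
    then have "(\<lambda>n. \<Sum>k<n. cinner (u k) x *\<^sub>C u k) \<longlonglongrightarrow> x"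
      using summable_LIMSEQ[OF *(1)] by simp
    moreover have "(\<Sum>k<n. cinner (u k) x *\<^sub>C u k) \<in> cspan (range u)" for n
      by (intro complex_vector.span_sum complex_vector.span_scale complex_vector.span_base) auto
    ultimately show ?thesis unfolding closure_sequential by (intro exI conjI allI)
  qed
  then show "closure (cspan (range u)) = UNIV" by blast
qed (rule orth)

lemma bounded_clinear_expansion:
  fixes e :: "nat \<Rightarrow> 'a::complex_inner"
  assumes "orthonormal_basis e" "bounded_clinear A"
  shows "(\<lambda>k. cinner (e k) x *\<^sub>C A (e k)) sums A x"
  using bounded_linear.sums[OF bounded_clinearD(1)[OF assms(2)] orthonormal_basis_expansion[OF assms(1), of x]]
  by (simp add: bounded_clinearD[OF assms(2)])

section \<open>Operators built from coefficients: adjoints and weighted permutations\<close>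

lemma exists_adjoint:
  fixes T :: "'a::chilbert_space \<Rightarrow> 'a" and e :: "nat \<Rightarrow> 'a"
  assumes e: "orthonormal_basis e" and T: "bounded_clinear T"
  shows "\<exists>S. bounded_clinear S \<and> (\<forall>x y. cinner (T x) y = cinner x (S y))"
proof -
  note orth = orthonormal_basisD[OF e]
  obtain K where K: "K > 0" "\<And>x. norm (T x) \<le> K * norm x" using bounded_clinear_bound[OF T] by metis
  have bd: "(\<Sum>k<n. (cmod (cinner (T (e k)) y))\<^sup>2) \<le> (K * norm y)\<^sup>2" for n y
  proof -
    define c where "c k = cinner (T (e k)) y" for k
    \<comment> \<open>\<open>z\<close> is a partial sum of the prospective adjoint at
      \<open>y\<close>. Testing \<open>T\<close> on it gives norm z squared = <y, T z>, which is at
      most K * norm y * norm z, and one factor norm z cancels.\<close>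
    define z where "z = (\<Sum>k<n. c k *\<^sub>C e k)"
    have nz: "(norm z)\<^sup>2 = (\<Sum>k<n. (cmod (c k))\<^sup>2)"
    proof -
      have "norm (e k) = 1" for k by (simp add: norm_eq_1I orth)
      then show ?thesis unfolding z_def
        by (subst norm_sum_orth) (auto simp: orth cinner_scaleC_left cinner_scaleC_right norm_scaleC)
    qed
    have "T z = (\<Sum>k<n. c k *\<^sub>C T (e k))"
      unfolding z_def by (simp add: linear_sum[OF bounded_linear.linear[OF bounded_clinearD(1)[OF T]]]
          bounded_clinearD(2)[OF T])
    then have "cinner y (T z) = (\<Sum>k<n. c k * cnj (c k))"
      by (simp add: cinner_sum_right cinner_scaleC_right c_def flip: cinner_commute)
    also have "\<dots> = of_real ((norm z)\<^sup>2)" unfolding nz by (simp add: complex_norm_square[symmetric])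
    finally have "(norm z)\<^sup>2 = cmod (cinner y (T z))" by (simp add: norm_power)
    also have "\<dots> \<le> norm y * (K * norm z)"
      by (rule order_trans[OF Cauchy_Schwarz_cinner]) (simp add: K mult_left_mono)
    finally have "norm z * norm z \<le> (K * norm y) * norm z" by (simp add: power2_eq_square mult_ac)
    then have "norm z \<le> K * norm y" using K(1)
      by (cases "z = 0") (simp, meson mult_right_le_imp_le zero_less_norm_iff)
    then have "(norm z)\<^sup>2 \<le> (K * norm y)\<^sup>2" by (rule power_mono) simp
    then show ?thesis unfolding nz c_def .
  qed
  define S where "S y = (\<Sum>k. cinner (T (e k)) y *\<^sub>C e k)" for y
  have coeff: "cinner (e i) (S y) = cinner (T (e i)) y" for i y
    unfolding S_def by (rule orthonormal_summable(3)[OF orth bd[where y = y]])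
  have adj: "cinner (T x) y = cinner x (S y)" for x y
  proof -
    have "(\<lambda>k. cinner y (cinner (e k) x *\<^sub>C T (e k))) sums cinner y (T x)"
      by (rule bounded_linear.sums[OF bounded_linear_cinner_right bounded_clinear_expansion[OF e T]])
    moreover have "(\<lambda>k. cinner (S y) (cinner (e k) x *\<^sub>C e k)) sums cinner (S y) x"
      by (rule bounded_linear.sums[OF bounded_linear_cinner_right orthonormal_basis_expansion[OF e]])
    moreover have "cinner y (T (e k)) = cinner (S y) (e k)" for k
      using coeff[of k y] by (metis cinner_commute)
    ultimately have "cinner y (T x) = cinner (S y) x"
      using sums_unique2 by (fastforce simp: cinner_scaleC_right)
    then show ?thesis by (metis cinner_commute)
  qed
  have "bounded_clinear S"
  proof (rule bounded_clinearI[where K = K])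
    fix x y show "S (x + y) = S x + S y"
      using orthonormal_basis_zeroI[OF e, of "S (x + y) - (S x + S y)"]
      by (simp add: cinner_diff_right cinner_add_right coeff)
  next
    fix c x show "S (c *\<^sub>C x) = c *\<^sub>C S x"
      using orthonormal_basis_zeroI[OF e, of "S (c *\<^sub>C x) - c *\<^sub>C S x"]
      by (simp add: cinner_diff_right cinner_scaleC_right coeff)
  next
    fix x show "norm (S x) \<le> K * norm x"
      unfolding S_def using K(1)
      by (intro power2_le_imp_le[OF orthonormal_summable(2)[OF orth bd[where y = x]]]) simp
  qed
  then show ?thesis using adj by blast
qed

text \<open>The source of all shifts below: the weighted bilateral shift, the unweighted one and its
  inverse. Injectivity of \<open>s\<close> keeps the image vectors orthonormal, so Bessel's bound
  for the coefficients bounds the series.\<close>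

lemma exists_weighted_permutation:
  fixes v :: "nat \<Rightarrow> 'a::chilbert_space"
  assumes v: "orthonormal_basis v" and s: "inj s" and w: "\<And>k. cmod (w k) \<le> 1"
  shows "\<exists>A. bounded_clinear A \<and> (\<forall>x. norm (A x) \<le> norm x) \<and> (\<forall>k. A (v k) = w k *\<^sub>C v (s k))"
proof -
  note orth = orthonormal_basisD[OF v]
  have orth': "cinner (v (s i)) (v (s j)) = (if i = j then 1 else 0)" for i j
    using s by (auto simp: orth inj_eq)
  define A where "A x = (\<Sum>k. (w k * cinner (v k) x) *\<^sub>C v (s k))" for x
  have bd: "(\<Sum>k<n. (cmod (w k * cinner (v k) x))\<^sup>2) \<le> (norm x)\<^sup>2" for n x
  proof -
    have "(\<Sum>k<n. (cmod (w k * cinner (v k) x))\<^sup>2) \<le> (\<Sum>k<n. (cmod (cinner (v k) x))\<^sup>2)"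
      by (intro sum_mono power_mono) (auto simp: norm_mult w mult_left_le_one_le)
    also have "\<dots> \<le> (norm x)\<^sup>2" by (rule Bessel_inequality) (auto simp: orth)
    finally show ?thesis .
  qed
  have S: "summable (\<lambda>k. (w k * cinner (v k) x) *\<^sub>C v (s k))" for x
    by (rule orthonormal_summable(1)[OF orth' bd[where x = x]])
  have nA: "norm (A x) \<le> norm x" for x
    unfolding A_def by (intro power2_le_imp_le[OF orthonormal_summable(2)[OF orth' bd[where x = x]]]) simp
  have "bounded_clinear A"
  proof (rule bounded_clinearI[where K = 1])
    fix x y show "A (x + y) = A x + A y"
      unfolding A_def by (subst suminf_add[OF S S])
        (simp add: cinner_add_right algebra_simps scaleC_add_left)
  next
    fix c x show "A (c *\<^sub>C x) = c *\<^sub>C A x"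
      unfolding A_def by (subst bounded_linear.suminf[OF bounded_linear_scaleC S])
        (simp add: cinner_scaleC_right scaleC_scaleC mult_ac)
  qed (simp add: nA)
  moreover have "A (v k) = w k *\<^sub>C v (s k)" for k
  proof -
    have "A (v k) = (\<Sum>j. if j = k then w k *\<^sub>C v (s k) else 0)"
      unfolding A_def by (intro suminf_cong) (auto simp: orth)
    also have "\<dots> = w k *\<^sub>C v (s k)" by (rule sums_unique[symmetric, OF sums_single])
    finally show ?thesis .
  qed
  ultimately show ?thesis using nA by blast
qed

section \<open>Spectral projections of self-adjoint contractions\<close>

definition selfadjoint :: "('a::complex_inner \<Rightarrow> 'a) \<Rightarrow> bool" where
  "selfadjoint S \<longleftrightarrow> bounded_clinear S \<and> (\<forall>x y. cinner (S x) y = cinner x (S y))"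

lemma selfadjointD:
  assumes "selfadjoint S"
  shows "bounded_clinear S" "cinner (S x) y = cinner x (S y)"
  using assms by (auto simp: selfadjoint_def)

lemma selfadjoint_id: "selfadjoint (\<lambda>x. x)"
  by (simp add: selfadjoint_def bounded_clinear_id)

lemma selfadjoint_add: "selfadjoint S \<Longrightarrow> selfadjoint R \<Longrightarrow> selfadjoint (\<lambda>x. S x + R x)"
  by (simp add: selfadjoint_def bounded_clinear_add cinner_add_left cinner_add_right)

lemma selfadjoint_diff: "selfadjoint S \<Longrightarrow> selfadjoint R \<Longrightarrow> selfadjoint (\<lambda>x. S x - R x)"
  by (simp add: selfadjoint_def bounded_clinear_diff cinner_diff_left cinner_diff_right)

lemma selfadjoint_scaleR: "selfadjoint S \<Longrightarrow> selfadjoint (\<lambda>x. r *\<^sub>R S x)"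
  by (simp add: selfadjoint_def bounded_clinear_scaleR cinner_scaleR_left cinner_scaleR_right)

lemma selfadjoint_square: "selfadjoint S \<Longrightarrow> selfadjoint (\<lambda>x. S (S x))"
  by (simp add: selfadjoint_def bounded_clinear_compose)

lemmas selfadjoint_intros =
  selfadjoint_id selfadjoint_add selfadjoint_diff selfadjoint_scaleR selfadjoint_square

text \<open>Collects what survives pointwise limits, for use with both iterations below. The uniform
  norm bound is essential for the squares: it makes \<open>F n (F n x - L x)\<close> tend to
  0.\<close>

lemma limit_of_contractions:
  assumes F: "\<And>n. bounded_clinear (F n)" "\<And>n x. norm (F n x) \<le> norm x"
    and lim: "\<And>x. (\<lambda>n. F n x) \<longlonglongrightarrow> L x"
  shows "bounded_clinear L"
    and "norm (L x) \<le> norm x"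
    and "(\<lambda>n. F n (F n x)) \<longlonglongrightarrow> L (L x)"
    and "bounded_clinear V \<Longrightarrow> (\<And>n x. V (F n x) = F n (V x)) \<Longrightarrow> V (L x) = L (V x)"
    and "(\<And>n. selfadjoint (F n)) \<Longrightarrow> selfadjoint L"
proof -
  show norm: "norm (L x) \<le> norm x" for x
    by (rule Lim_bounded[OF tendsto_norm[OF lim]]) (simp add: F(2))
  show bc: "bounded_clinear L"
  proof (rule bounded_clinearI[where K = 1])
    fix x y
    have "(\<lambda>n. F n (x + y)) \<longlonglongrightarrow> L x + L y"
      using tendsto_add[OF lim[of x] lim[of y]] by (simp add: bounded_clinearD[OF F(1)])
    then show "L (x + y) = L x + L y" using lim LIMSEQ_unique by blast
  next
    fix c x
    have "(\<lambda>n. F n (c *\<^sub>C x)) \<longlonglongrightarrow> c *\<^sub>C L x"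
      using tendsto_scaleC[OF lim[of x]] by (simp add: bounded_clinearD(2)[OF F(1)])
    then show "L (c *\<^sub>C x) = c *\<^sub>C L x" using lim LIMSEQ_unique by blast
  qed (simp add: norm)
  show "(\<lambda>n. F n (F n x)) \<longlonglongrightarrow> L (L x)"
  proof -
    have "(\<lambda>n. F n (F n x - L x)) \<longlonglongrightarrow> 0"
    proof (rule Lim_null_comparison)
      show "\<forall>\<^sub>F n in sequentially. norm (F n (F n x - L x)) \<le> norm (F n x - L x)"
        by (simp add: F(2))
      show "(\<lambda>n. norm (F n x - L x)) \<longlonglongrightarrow> 0"
        using lim[of x] by (simp add: LIM_zero_iff tendsto_norm_zero_iff)
    qed
    from tendsto_add[OF this lim[of "L x"]] show ?thesis
      by (simp add: bounded_clinearD(4)[OF F(1)])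
  qed
  show "V (L x) = L (V x)" if "bounded_clinear V" "\<And>n x. V (F n x) = F n (V x)" for V
    using bounded_clinear_tendsto[OF that(1) lim[of x]] lim[of "V x"] LIMSEQ_unique
    by (auto simp: that(2))
  show "selfadjoint L" if sa: "\<And>n. selfadjoint (F n)"
    unfolding selfadjoint_def
  proof (intro conjI allI bc)
    fix x y
    have "(\<lambda>n. cinner (F n x) y) \<longlonglongrightarrow> cinner (L x) y" by (rule tendsto_cinner_left[OF lim])
    moreover have "(\<lambda>n. cinner (F n x) y) \<longlonglongrightarrow> cinner x (L y)"
      using tendsto_cinner_right[OF lim[of y]] by (simp add: selfadjointD(2)[OF sa])
    ultimately show "cinner (L x) y = cinner x (L y)" using LIMSEQ_unique by blast
  qed
qed

lemma Re_cinner_le: "Re (cinner x y) \<le> norm x * norm y"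
  using complex_Re_le_cmod Cauchy_Schwarz_cinner order_trans by blast

text \<open>Expanding the square gives cross term -2 (norm (S x))^2, of which the term (norm (S (S
  x)))^2 takes back at most half. Besides contractivity of 1 - S^2 this shows that a vector whose
  norm is not decreased by 1 - S^2 lies in the kernel of \<open>S\<close>.\<close>

lemma norm_minus_square_sq_le:
  assumes S: "selfadjoint S" and contr: "\<And>x. norm (S x) \<le> norm x"
  shows "(norm (x - S (S x)))\<^sup>2 \<le> (norm x)\<^sup>2 - (norm (S x))\<^sup>2"
proof -
  have "Re (cinner x (S (S x))) = (norm (S x))\<^sup>2"
    by (simp add: norm_sq_cinner selfadjointD(2)[OF S])
  moreover have "(norm (S (S x)))\<^sup>2 \<le> (norm (S x))\<^sup>2" by (intro power_mono contr) simp
  ultimately show ?thesis by (simp add: norm_diff_sq)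
qed

lemma norm_minus_square_le:
  assumes "selfadjoint S" and "\<And>x. norm (S x) \<le> norm x"
  shows "norm (x - S (S x)) \<le> norm x"
proof -
  have "(norm (x - S (S x)))\<^sup>2 \<le> (norm x)\<^sup>2"
    using norm_minus_square_sq_le[OF assms, of x] by (smt (verit) zero_le_power2)
  then show ?thesis by (rule power2_le_imp_le) simp
qed

text \<open>The square root is obtained from the iteration \<open>Y \<mapsto> (C + Y\<^sup>2) / 2\<close> with \<open>C = 1 - B\<^sup>2\<close>, whose
  limit \<open>L\<close> satisfies \<open>(1 - L)\<^sup>2 = B\<^sup>2\<close>. Its increments are dominated by those of the scalar
  iteration \<open>r \<mapsto> (1 + r\<^sup>2) / 2\<close>, which increases and stays below 1.\<close>

lemma exists_absolute_value:
  fixes B :: "'a::chilbert_space \<Rightarrow> 'a"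
  assumes B: "selfadjoint B" and contr: "\<And>x. norm (B x) \<le> norm x"
  shows "\<exists>R. selfadjoint R \<and> (\<forall>x. norm (R x) = norm (B x)) \<and> (\<forall>x. 0 \<le> Re (cinner x (R x))) \<and>
    (\<forall>x. R (R x) = B (B x)) \<and>
    (\<forall>V. bounded_clinear V \<longrightarrow> (\<forall>x. V (B x) = B (V x)) \<longrightarrow> (\<forall>x. V (R x) = R (V x)))"
proof -
  define C where "C x = x - B (B x)" for x
  have C: "selfadjoint C" unfolding C_def by (intro selfadjoint_intros B)
  have nC: "norm (C x) \<le> norm x" for x unfolding C_def by (rule norm_minus_square_le[OF B contr])
  define Y where "Y = rec_nat (\<lambda>x. 0) (\<lambda>n Z x. (1/2) *\<^sub>R (C x + Z (Z x)))"
  have Y0: "Y 0 x = 0" and YS: "Y (Suc n) x = (1/2) *\<^sub>R (C x + Y n (Y n x))" for n x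
    by (simp_all add: Y_def)
  define y :: "nat \<Rightarrow> real" where "y = rec_nat 0 (\<lambda>n r. (1 + r\<^sup>2) / 2)"
  have y0: "y 0 = 0" and yS: "y (Suc n) = (1 + (y n)\<^sup>2) / 2" for n by (simp_all add: y_def)
  have y_bounds: "0 \<le> y n \<and> y n \<le> 1" for n
    by (induction n) (auto simp: y0 yS power_le_one)
  have y_mono: "y n \<le> y (Suc n)" for n
  proof -
    have "0 \<le> (1 - y n)\<^sup>2" by simp
    then show ?thesis unfolding yS power2_eq_square by (simp add: algebra_simps)
  qed
  have Y_sa: "selfadjoint (Y n)" for n
  proof (induction n)
    case 0
    then show ?case using selfadjoint_scaleR[OF selfadjoint_id, of 0] by (simp add: Y_def)
  next
    case (Suc n)
    have "Y (Suc n) = (\<lambda>x. (1/2) *\<^sub>R (C x + Y n (Y n x)))" by (rule ext) (rule YS)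
    then show ?case by (simp only:) (intro selfadjoint_intros C Suc)
  qed
  have Y_norm: "norm (Y n x) \<le> y n * norm x" for n x
  proof (induction n arbitrary: x)
    case (Suc n)
    have "norm (Y n (Y n x)) \<le> y n * (y n * norm x)"
      using Suc.IH[of "Y n x"] mult_left_mono[OF Suc.IH[of x], of "y n"] y_bounds[of n] by linarith
    then have "norm (C x + Y n (Y n x)) \<le> norm x + y n * (y n * norm x)"
      using norm_triangle_ineq[of "C x" "Y n (Y n x)"] nC[of x] by linarith
    then show ?case by (simp add: YS yS power2_eq_square distrib_right mult.assoc)
  qed (simp add: Y0 y0)
  have Y_contr: "norm (Y n x) \<le> norm x" for n x
    using Y_norm[of n x] mult_right_mono[of "y n" 1 "norm x"] y_bounds[of n] by simp
  have Y_diff: "norm (Y (Suc n) x - Y n x) \<le> (y (Suc n) - y n) * norm x" for n x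
  proof (induction n arbitrary: x)
    case 0
    then show ?case using nC[of x] by (simp add: YS Y0 yS y0 bounded_clinearD(5))
  next
    case (Suc n)
    define Y' Y'' where "Y' = Y (Suc n)" and "Y'' = Y n"
    define \<delta> where "\<delta> = y (Suc n) - y n"
    have \<delta>: "0 \<le> \<delta>" using y_mono by (simp add: \<delta>_def)
    have "Y (Suc (Suc n)) x - Y (Suc n) x = (1/2) *\<^sub>R (Y' (Y' x) - Y'' (Y'' x))"
      by (subst (1) YS, subst (2) YS) (simp add: Y'_def Y''_def scaleR_diff_right[symmetric])
    \<comment> \<open>This splitting lets the induction hypothesis act on both terms, at
      \<open>x\<close> and at \<open>Y'' x\<close>. The scalar recursion factors its difference of
      squares in the same way, so the bounds match exactly.\<close>
    also have "Y' (Y' x) - Y'' (Y'' x) = Y' (Y' x - Y'' x) + (Y' (Y'' x) - Y'' (Y'' x))"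
      by (simp add: Y'_def bounded_clinearD(4)[OF selfadjointD(1)[OF Y_sa]])
    finally have "norm (Y (Suc (Suc n)) x - Y (Suc n) x)
        = (1/2) * norm (Y' (Y' x - Y'' x) + (Y' (Y'' x) - Y'' (Y'' x)))"
      by simp
    also have "\<dots> \<le> (1/2) * (y (Suc n) * (\<delta> * norm x) + \<delta> * (y n * norm x))"
    proof -
      have "norm (Y' (Y' x - Y'' x)) \<le> y (Suc n) * (\<delta> * norm x)"
        using Y_norm[of "Suc n" "Y' x - Y'' x"] mult_left_mono[OF Suc.IH[of x], of "y (Suc n)"]
          y_bounds[of "Suc n"] unfolding Y'_def Y''_def \<delta>_def by linarith
      moreover have "norm (Y' (Y'' x) - Y'' (Y'' x)) \<le> \<delta> * (y n * norm x)"
        using Suc.IH[of "Y'' x"] mult_left_mono[OF Y_norm[of n x] \<delta>]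
        unfolding Y'_def Y''_def \<delta>_def by linarith
      ultimately show ?thesis
        using norm_triangle_ineq[of "Y' (Y' x - Y'' x)" "Y' (Y'' x) - Y'' (Y'' x)"] by simp
    qed
    also have "\<dots> = (y (Suc (Suc n)) - y (Suc n)) * norm x"
    proof -
      have "2 * y (Suc k) = 1 + y k * y k" for k by (simp add: yS power2_eq_square)
      note this[of "Suc n"] this[of n]
      moreover have "(y (Suc n) + y n) * \<delta> = y (Suc n) * y (Suc n) - y n * y n"
        by (simp add: \<delta>_def algebra_simps)
      ultimately have "y (Suc (Suc n)) - y (Suc n) = (1/2) * ((y (Suc n) + y n) * \<delta>)" by linarith
      then show ?thesis by (simp add: algebra_simps)
    qed
    finally show ?case .
  qed
  have "\<exists>l. (\<lambda>n. Y n x) \<longlonglongrightarrow> l" for x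
  proof -
    obtain l where "y \<longlonglongrightarrow> l"
      using Bseq_monoseq_convergent[of y] y_bounds y_mono
      by (metis BseqI' abs_of_nonneg convergent_def mono_SucI1 real_norm_def)
    then have "summable (\<lambda>n. (y (Suc n) - y n) * norm x)"
      by (intro summable_mult2 telescope_summable)
    then have "summable (\<lambda>n. Y (Suc n) x - Y n x)"
      by (rule summable_comparison_test') (rule Y_diff)
    from summable_LIMSEQ[OF this] show ?thesis
      by (intro exI) (simp add: sum_lessThan_telescope[of "\<lambda>n. Y n x"] Y0)
  qed
  then obtain L where lim: "\<And>x. (\<lambda>n. Y n x) \<longlonglongrightarrow> L x" by metis
  note L = limit_of_contractions[of Y L, OF selfadjointD(1)[OF Y_sa] Y_contr lim]
  have fixpoint: "L x = (1/2) *\<^sub>R (C x + L (L x))" for x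
  proof -
    have "(\<lambda>n. Y (Suc n) x) \<longlonglongrightarrow> (1/2) *\<^sub>R (C x + L (L x))"
      unfolding YS by (intro tendsto_intros L(3))
    moreover have "(\<lambda>n. Y (Suc n) x) \<longlonglongrightarrow> L x" using lim by (rule LIMSEQ_Suc)
    ultimately show ?thesis using LIMSEQ_unique by blast
  qed
  define R where "R x = x - L x" for x
  have R: "selfadjoint R" unfolding R_def by (intro selfadjoint_intros L(5) Y_sa)
  have RR: "R (R x) = B (B x)" for x
  proof -
    have "2 *\<^sub>R L x = C x + L (L x)" by (subst fixpoint) simp
    then have "L (L x) = L x + L x - C x" by (simp add: scaleR_2 algebra_simps)
    then show ?thesis by (simp add: R_def bounded_clinearD(4)[OF L(1)] C_def)
  qed
  have "norm (R x) = norm (B x)" for x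
  proof -
    have "(norm (R x))\<^sup>2 = (norm (B x))\<^sup>2"
      by (simp add: norm_sq_cinner selfadjointD(2)[OF R] selfadjointD(2)[OF B] RR)
    then show ?thesis by (rule power2_eq_imp_eq) auto
  qed
  moreover have "0 \<le> Re (cinner x (R x))" for x
  proof -
    have "Re (cinner x (L x)) \<le> norm x * norm x"
      by (rule order_trans[OF Re_cinner_le]) (intro mult_left_mono L(2) norm_ge_zero)
    then show ?thesis by (simp add: R_def cinner_diff_right norm_sq_cinner[symmetric] power2_eq_square)
  qed
  moreover have "V (R x) = R (V x)" if V: "bounded_clinear V" "\<And>x. V (B x) = B (V x)" for V x
  proof -
    note V_simps = bounded_clinearD[OF V(1)] V(2)
    \<comment> \<open>Every iterate is a polynomial in \<open>B\<close>, so it commutes with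
      whatever commutes with \<open>B\<close>; the limit inherits this.\<close>
    have "V (Y n x) = Y n (V x)" for n x
      by (induction n arbitrary: x) (simp_all add: Y0 YS C_def V_simps)
    from L(4)[OF V(1) this] show ?thesis by (simp add: R_def V_simps)
  qed
  ultimately show ?thesis using R RR by blast
qed

text \<open>In terms of functional calculus, Z = 1 - S^2 takes values in [0, 1] and equals 1 exactly
  where \<open>S\<close> vanishes, so its powers converge pointwise to the projection onto the
  kernel of \<open>S\<close>. Convergence is obtained directly from the decreasing norms of the
  iterates.\<close>

lemma exists_kernel_projection:
  fixes S :: "'a::chilbert_space \<Rightarrow> 'a"
  assumes S: "selfadjoint S" and contr: "\<And>x. norm (S x) \<le> norm x"
  shows "\<exists>F. selfadjoint F \<and> (\<forall>x. F (F x) = F x) \<and> (\<forall>x. S x = 0 \<longleftrightarrow> F x = x) \<and>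
    (\<forall>V. bounded_clinear V \<longrightarrow> (\<forall>x. V (S x) = S (V x)) \<longrightarrow> (\<forall>x. V (F x) = F (V x)))"
proof -
  define Z where "Z x = x - S (S x)" for x
  have Z: "selfadjoint Z" unfolding Z_def by (intro selfadjoint_intros S)
  have nZ: "norm (Z x) \<le> norm x" for x unfolding Z_def by (rule norm_minus_square_le[OF S contr])
  have Z_adj: "cinner ((Z ^^ n) x) y = cinner x ((Z ^^ n) y)" for n x y
  proof (induction n arbitrary: y)
    case (Suc n)
    have "cinner ((Z ^^ Suc n) x) y = cinner x ((Z ^^ n) (Z y))"
      by (simp add: selfadjointD(2)[OF Z] Suc)
    then show ?case by (simp add: funpow_swap1)
  qed simp
  have Z_bc: "bounded_clinear (Z ^^ n)" for n
  proof (induction n)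
    case (Suc n)
    then show ?case using bounded_clinear_compose[OF selfadjointD(1)[OF Z]] by (simp add: comp_def)
  qed (simp add: bounded_clinear_id id_def)
  have Z_contr: "norm ((Z ^^ n) x) \<le> norm x" for n x
    by (induction n) (auto intro: order_trans[OF nZ])
  have "convergent (\<lambda>n. (Z ^^ (2 * n)) x)" for x
  proof -
    define b where "b n = (norm ((Z ^^ n) x))\<^sup>2" for n
    have "decseq b" unfolding b_def by (intro decseq_SucI power_mono) (simp_all add: nZ)
    moreover have "0 \<le> b n" for n by (simp add: b_def)
    ultimately obtain l where l: "b \<longlonglongrightarrow> l" using decseq_convergent by metis
    \<comment> \<open>With even exponents the cross term is again a member \<open>b (m + n)\<close>
      of the convergent sequence, so the three terms tend to l - 2 l + l = 0. The coefficients 1, 2,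
      1 explain the tolerance of a quarter below.\<close>
    have b_diff: "(norm ((Z ^^ (2*m)) x - (Z ^^ (2*n)) x))\<^sup>2 = b (2*m) - 2 * b (m + n) + b (2*n)" for m n
    proof -
      have "cinner ((Z ^^ (2*m)) x) ((Z ^^ (2*n)) x) = cinner ((Z ^^ (m + n)) x) ((Z ^^ (m + n)) x)"
        unfolding Z_adj by (simp add: mult_2 add_ac flip: comp_apply[of "Z ^^ _"] funpow_add)
      then show ?thesis by (simp add: norm_diff_sq b_def norm_sq_cinner[symmetric])
    qed
    have "Cauchy (\<lambda>n. (Z ^^ (2 * n)) x)"
    proof (rule metric_CauchyI)
      fix \<epsilon> :: real assume \<epsilon>: "\<epsilon> > 0"
      then obtain M where M: "\<And>n. n \<ge> M \<Longrightarrow> \<bar>b n - l\<bar> < \<epsilon>\<^sup>2 / 4"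
        using LIMSEQ_D[OF l, of "\<epsilon>\<^sup>2 / 4"] by auto
      have "dist ((Z ^^ (2 * m)) x) ((Z ^^ (2 * n)) x) < \<epsilon>" if "m \<ge> M" "n \<ge> M" for m n
      proof -
        have "(norm ((Z ^^ (2*m)) x - (Z ^^ (2*n)) x))\<^sup>2 < \<epsilon>\<^sup>2"
          unfolding b_diff using M[of "2*m"] M[of "m+n"] M[of "2*n"] that by linarith
        from power2_less_imp_less[OF this] show ?thesis using \<epsilon> by (simp add: dist_norm)
      qed
      then show "\<exists>M. \<forall>m\<ge>M. \<forall>n\<ge>M. dist ((Z ^^ (2 * m)) x) ((Z ^^ (2 * n)) x) < \<epsilon>" by blast
    qed
    then show ?thesis by (rule Cauchy_convergent)
  qed
  then obtain F where lim: "\<And>x. (\<lambda>n. (Z ^^ (2 * n)) x) \<longlonglongrightarrow> F x"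
    unfolding convergent_def by metis
  note F = limit_of_contractions[of "\<lambda>n. Z ^^ (2 * n)" F, OF Z_bc Z_contr lim]
  have SF: "S (F x) = 0" for x
  proof -
    have "(\<lambda>n. Z (Z ((Z ^^ (2 * n)) x))) \<longlonglongrightarrow> Z (Z (F x))"
      by (rule bounded_clinear_tendsto[OF selfadjointD(1)[OF Z]
            bounded_clinear_tendsto[OF selfadjointD(1)[OF Z] lim]])
    moreover have "(\<lambda>n. Z (Z ((Z ^^ (2 * n)) x))) \<longlonglongrightarrow> F x"
      using LIMSEQ_Suc[OF lim[of x]] by simp
    ultimately have "Z (Z (F x)) = F x" using LIMSEQ_unique by blast
    \<comment> \<open>Since Z^2 fixes \<open>F x\<close>, neither application of \<open>Z\<close>
      can shrink it; equality in the contraction estimate then forces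
      \<open>S (F x) = 0\<close>.\<close>
    then have "norm (F x) \<le> norm (Z (F x))" using nZ[of "Z (F x)"] by simp
    then have "(norm (F x))\<^sup>2 \<le> (norm (Z (F x)))\<^sup>2" by (rule power_mono) simp
    then have "(norm (S (F x)))\<^sup>2 \<le> 0"
      using norm_minus_square_sq_le[OF S contr, of "F x"] unfolding Z_def by linarith
    then show ?thesis by simp
  qed
  have FS: "F x = x" if "S x = 0" for x
  proof -
    have "Z x = x" using that by (simp add: Z_def bounded_clinearD(5)[OF selfadjointD(1)[OF S]])
    then have "(Z ^^ n) x = x" for n by (induction n) auto
    then show ?thesis using lim[of x] by (simp add: LIMSEQ_const_iff)
  qed
  have "selfadjoint F" using Z_bc Z_adj by (intro F(5)) (simp add: selfadjoint_def)
  moreover have "V (F x) = F (V x)" if V: "bounded_clinear V" "\<And>x. V (S x) = S (V x)" for V x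
  proof (rule F(4)[OF V(1)])
    have "V (Z x) = Z (V x)" for x by (simp add: Z_def bounded_clinearD(4)[OF V(1)] V(2))
    then have "V ((Z ^^ n) x) = (Z ^^ n) (V x)" for n x by (induction n) auto
    then show "V ((Z ^^ (2 * n)) x) = (Z ^^ (2 * n)) (V x)" for n x .
  qed
  ultimately show ?thesis using SF FS by metis
qed

text \<open>\<open>F\<close> projects onto the kernel of the positive part of G - l, which is the
  spectral subspace of \<open>G\<close> for values up to \<open>l\<close>. The clause on
  \<open>V\<close> says that \<open>F\<close> commutes with everything commuting with
  \<open>G\<close>; through it the projections for different \<open>l\<close> will commute with each
  other.\<close>

lemma exists_spectral_projection:
  fixes G :: "'a::chilbert_space \<Rightarrow> 'a"
  assumes G: "selfadjoint G" and contr: "\<And>x. norm (G x) \<le> norm x" and l: "0 \<le> l" "l \<le> 1"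
  shows "\<exists>F. selfadjoint F \<and> (\<forall>x. F (F x) = F x) \<and>
    (\<forall>x. F x = x \<longrightarrow> Re (cinner x (G x)) \<le> l * (norm x)\<^sup>2) \<and>
    (\<forall>x. F x = 0 \<longrightarrow> l * (norm x)\<^sup>2 \<le> Re (cinner x (G x))) \<and>
    (\<forall>V. bounded_clinear V \<longrightarrow> (\<forall>x. V (G x) = G (V x)) \<longrightarrow> (\<forall>x. V (F x) = F (V x)))"
proof -
  \<comment> \<open>The factor 1/2 only makes \<open>B\<close> a contraction, as the absolute value
    requires. Below, \<open>R\<close> is the absolute value of \<open>B\<close> and \<open>P\<close>
    its positive part.\<close>
  define B where "B x = (1/2) *\<^sub>R (G x - l *\<^sub>R x)" for x
  have B: "selfadjoint B" unfolding B_def by (intro selfadjoint_intros G)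
  have nB: "norm (B x) \<le> norm x" for x
  proof -
    have "norm (G x - l *\<^sub>R x) \<le> norm (G x) + l * norm x"
      using norm_triangle_ineq4[of "G x" "l *\<^sub>R x"] l by simp
    also have "\<dots> \<le> norm x + 1 * norm x" by (intro add_mono contr mult_right_mono l) simp
    finally show ?thesis by (simp add: B_def)
  qed
  have Re_B: "2 * Re (cinner x (B x)) = Re (cinner x (G x)) - l * (norm x)\<^sup>2" for x
    by (simp add: B_def cinner_scaleR_right cinner_diff_right cinner_self)
  obtain R where R: "selfadjoint R" and nR: "\<And>x. norm (R x) = norm (B x)"
    and R_pos: "\<And>x. 0 \<le> Re (cinner x (R x))" and RR: "\<And>x. R (R x) = B (B x)"
    and R_comm: "\<And>V x. bounded_clinear V \<Longrightarrow> (\<forall>x. V (B x) = B (V x)) \<Longrightarrow> V (R x) = R (V x)"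
    using exists_absolute_value[OF B nB] by blast
  note B_simps = bounded_clinearD[OF selfadjointD(1)[OF B]]
  note R_simps = bounded_clinearD[OF selfadjointD(1)[OF R]]
  have BR: "B (R x) = R (B x)" for x by (rule R_comm[OF selfadjointD(1)[OF B]]) simp
  define P where "P x = (1/2) *\<^sub>R (R x + B x)" for x
  have P: "selfadjoint P" unfolding P_def by (intro selfadjoint_intros R B)
  have nP: "norm (P x) \<le> norm x" for x
    using norm_triangle_ineq[of "R x" "B x"] nB[of x] by (simp add: P_def nR)
  obtain F where F: "selfadjoint F" and FF: "\<And>x. F (F x) = F x"
    and F_iff: "\<And>x. P x = 0 \<longleftrightarrow> F x = x"
    and F_comm: "\<And>V x. bounded_clinear V \<Longrightarrow> (\<forall>x. V (P x) = P (V x)) \<Longrightarrow> V (F x) = F (V x)"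
    using exists_kernel_projection[OF P nP] by blast
  have "Re (cinner x (G x)) \<le> l * (norm x)\<^sup>2" if "F x = x" for x
  proof -
    have "R x + B x = 0" using that F_iff[of x] by (simp add: P_def)
    then have "cinner x (R x) + cinner x (B x) = 0" by (simp flip: cinner_add_right)
    then have "Re (cinner x (R x)) + Re (cinner x (B x)) = 0" by (metis plus_complex.sel(1) zero_complex.sel(1))
    then show ?thesis using R_pos[of x] Re_B[of x] by linarith
  qed
  moreover have "l * (norm x)\<^sup>2 \<le> Re (cinner x (G x))" if "F x = 0" for x
  proof -
    \<comment> \<open>\<open>N\<close> is the negative part, and \<open>P N\<close> = (R^2 - B^2) /
      4 = 0 because \<open>R\<close> and \<open>B\<close> commute. So \<open>F\<close> fixes the
      range of \<open>N\<close>, while commuting with \<open>N\<close>; hence \<open>F x = 0\<close>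
      gives \<open>N x = 0\<close>, that is, \<open>R x = B x\<close>.\<close>
    define N where "N x = (1/2) *\<^sub>R (R x - B x)" for x
    have N: "selfadjoint N" unfolding N_def by (intro selfadjoint_intros R B)
    have PN: "P (N z) = 0" and NP: "N (P z) = 0" for z
      by (simp_all add: P_def N_def B_simps R_simps BR RR scaleR_diff_right)
    have "N x = F (N x)" using F_iff PN by metis
    also have "\<dots> = N (F x)" by (rule F_comm[symmetric, OF selfadjointD(1)[OF N]]) (simp add: PN NP)
    also have "\<dots> = 0" by (simp add: that bounded_clinearD(5)[OF selfadjointD(1)[OF N]])
    finally have "R x = B x" by (simp add: N_def)
    then show ?thesis using R_pos[of x] Re_B[of x] by simp
  qed
  moreover have "V (F x) = F (V x)" if V: "bounded_clinear V" "\<forall>x. V (G x) = G (V x)" for V x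
  proof -
    note V_simps = bounded_clinearD[OF V(1)]
    have VB: "V (B x) = B (V x)" for x using V(2) by (simp add: B_def V_simps)
    then have "V (R x) = R (V x)" for x using R_comm V(1) by blast
    then have "V (P x) = P (V x)" for x by (simp add: P_def V_simps VB)
    then show ?thesis using F_comm V(1) by blast
  qed
  ultimately show ?thesis using F FF by blast
qed

section \<open>Weighted bilateral shifts\<close>

lemma bounded_clinear_eqI:
  fixes v :: "nat \<Rightarrow> 'a::complex_inner"
  assumes "orthonormal_basis v" "bounded_clinear A" "bounded_clinear B" "\<And>k. A (v k) = B (v k)"
  shows "A x = B x"
  using bounded_clinear_expansion[OF assms(1,2), of x] bounded_clinear_expansion[OF assms(1,3), of x]
  by (simp add: assms(4) sums_unique2)

text \<open>A shift with weights \<open>w\<close> along u moves \<beta>_j u_j to \<beta>_(j+1)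
  u_(j+1), so this rescaling removes the weights. Normalized by \<beta>_0 = 1, the formula
  multiplies weights to the right of 0 and divides by them to the left; one of its two products is
  always empty.\<close>

lemma exists_weight_products:
  fixes w :: "int \<Rightarrow> real"
  assumes "\<And>j. 0 < w j"
  shows "\<exists>\<beta>. (\<forall>j. 0 < \<beta> j) \<and> (\<forall>j. \<beta> (j + 1) = w j * \<beta> j)"
proof (intro exI conjI allI)
  define \<beta> where "\<beta> j = (\<Prod>k\<in>{0..<j}. w k) / (\<Prod>k\<in>{j..<0}. w k)" for j
  show "0 < \<beta> j" for j unfolding \<beta>_def by (intro divide_pos_pos prod_pos) (simp_all add: assms)
  show "\<beta> (j + 1) = w j * \<beta> j" for j
  proof (cases "j \<ge> 0")
    case True
    then have "{0..<j + 1} = insert j {0..<j}" by auto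
    then show ?thesis using True by (simp add: \<beta>_def)
  next
    case False
    then have "{j..<0} = insert j {j + 1..<0}" by auto
    then show ?thesis using False assms[of j] by (simp add: \<beta>_def)
  qed
qed

text \<open>An operator commuting with the shift has a matrix that is constant along diagonals after
  rescaling by the products of the weights. Boundedness kills the strictly upper diagonals, as the
  weights come arbitrarily close to 0, and what remains is multiplication by a formal power series.\<close>

lemma bilateral_shift_commutant:
  fixes v :: "nat \<Rightarrow> 'a::chilbert_space"
  assumes v: "orthonormal_basis v"
    and w: "\<And>j. 0 < w j" "\<And>j. w j \<le> 1" and w_inf: "\<And>\<epsilon>. \<epsilon> > 0 \<Longrightarrow> \<exists>j. w j < \<epsilon>"
    and A: "bounded_clinear A"
    and shift: "\<And>j. A (v (int_encode j)) = of_real (w j) *\<^sub>C v (int_encode (j + 1))"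
    and P: "bounded_clinear P" and PP: "\<And>x. P (P x) = P x" and comm: "\<And>x. P (A x) = A (P x)"
  shows "(\<forall>x. P x = 0) \<or> (\<forall>x. P x = x)"
proof -
  define u where "u j = v (int_encode j)" for j
  have vu: "v k = u (int_decode k)" for k by (simp add: u_def)
  have orth: "cinner (u i) (u j) = (if i = j then 1 else 0)" for i j
    by (simp add: u_def orthonormal_basisD[OF v] int_encode_eq)
  have A_u: "A (u j) = of_real (w j) *\<^sub>C u (j + 1)" for j by (simp add: u_def shift)
  have cinner_A: "cinner (u (i + 1)) (A y) = of_real (w i) * cinner (u i) y" for i y
  proof -
    have "(\<lambda>k. cinner (u (i + 1)) (cinner (v k) y *\<^sub>C A (v k))) sums cinner (u (i + 1)) (A y)"
      by (rule bounded_linear.sums[OF bounded_linear_cinner_right bounded_clinear_expansion[OF v A]])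
    moreover have "cinner (u (i + 1)) (cinner (v k) y *\<^sub>C A (v k))
        = (if k = int_encode i then of_real (w i) * cinner (u i) y else 0)" for k
      by (auto simp: vu A_u cinner_scaleC_right orth)
    ultimately show ?thesis
      using sums_single[of "int_encode i" "\<lambda>_. of_real (w i) * cinner (u i) y"] sums_unique2 by simp
  qed
  obtain \<beta> where \<beta>: "\<And>j. 0 < \<beta> j" and \<beta>_Suc: "\<And>j. \<beta> (j + 1) = w j * \<beta> j"
    using exists_weight_products[of w] w(1) by metis
  have \<beta>_antimono: "\<beta> j \<le> \<beta> i" if "i \<le> j" for i j
    using that
  proof (induction j rule: int_ge_induct)
    case (step j)
    have "w j * \<beta> j \<le> \<beta> j" using w[of j] \<beta>[of j] by (simp add: mult_le_cancel_right1)
    then show ?case using step by (simp add: \<beta>_Suc)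
  qed simp
  define p where "p i j = cinner (u i) (P (u j))" for i j
  have p_Suc: "of_real (w j) * p (i + 1) (j + 1) = of_real (w i) * p i j" for i j
  proof -
    have "of_real (w j) * p (i + 1) (j + 1) = cinner (u (i + 1)) (P (A (u j)))"
      by (simp add: p_def A_u bounded_clinearD(2)[OF P] cinner_scaleC_right)
    then show ?thesis by (simp add: comm cinner_A p_def)
  qed
  \<comment> \<open>\<open>q\<close> is the matrix of \<open>P\<close> relative to the vectors
    \<beta>_j u_j, on which \<open>A\<close> acts as an unweighted shift; commuting with it means
    being constant along diagonals.\<close>
  define q where "q i j = p i j * of_real (\<beta> j / \<beta> i)" for i j
  have q_Suc: "q (i + 1) (j + 1) = q i j" for i j
  proof -
    have "q (i + 1) (j + 1) = (of_real (w j) * p (i + 1) (j + 1)) * of_real (\<beta> j / (w i * \<beta> i))"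
      by (simp add: q_def \<beta>_Suc)
    also have "\<dots> = p i j * of_real (w i * (\<beta> j / (w i * \<beta> i)))"
      unfolding p_Suc by simp
    also have "\<dots> = q i j" unfolding q_def using w(1)[of i] by simp
    finally show ?thesis .
  qed
  have q_add_nat: "q (i + int m) (j + int m) = q i j" for i j m
  proof (induction m)
    case (Suc m)
    then show ?case using q_Suc[of "i + int m" "j + int m"] by (simp add: ac_simps)
  qed simp
  have q_add: "q (i + m) (j + m) = q i j" for i j m
  proof (cases "m \<ge> 0")
    case True
    then show ?thesis using q_add_nat[of i "nat m" j] by simp
  next
    case False
    then show ?thesis using q_add_nat[of "i + m" "nat (- m)" "j + m"] by simp
  qed
  have norm_u: "norm (u j) = 1" for j by (simp add: norm_eq_1I orth)
  obtain K where K: "K > 0" "\<And>x. norm (P x) \<le> K * norm x" using bounded_clinear_bound[OF P] by metis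
  have p_bound: "cmod (p i j) \<le> K" for i j
    unfolding p_def using Cauchy_Schwarz_cinner[of "u i" "P (u j)"] K(2)[of "u j"] by (simp add: norm_u)
  have q_upper: "q i j = 0" if "i < j" for i j
  proof -
    have "cmod (q i j) \<le> 0 + \<epsilon>" if "\<epsilon> > 0" for \<epsilon>
    proof -
      obtain k where k: "w k < \<epsilon> / K" using w_inf[of "\<epsilon> / K"] \<open>\<epsilon> > 0\<close> K by auto
      \<comment> \<open>The translation moves column \<open>j\<close> to k + 1 and row
        \<open>i\<close> to at most \<open>k\<close>, so the ratio of the \<beta> is at most
        \<beta>_(k+1) / \<beta>_k = \<open>w k\<close>, the small weight.\<close>
      define m where "m = k + 1 - j"
      have "\<beta> (j + m) / \<beta> (i + m) \<le> \<beta> (j + m) / \<beta> k"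
        using \<open>i < j\<close> \<beta>_antimono[of "i + m" k] \<beta>
        by (intro divide_left_mono) (auto simp: m_def less_imp_le)
      also have "\<dots> = w k" using \<beta>_Suc[of k] \<beta>[of k] by (simp add: m_def)
      finally have "\<beta> (j + m) / \<beta> (i + m) \<le> w k" .
      moreover have "0 \<le> \<beta> (j + m) / \<beta> (i + m)" using \<beta> by (simp add: less_imp_le)
      ultimately have "cmod (p (i + m) (j + m)) * (\<beta> (j + m) / \<beta> (i + m)) \<le> K * w k"
        using K(1) by (intro mult_mono p_bound) auto
      moreover have "cmod (q i j) = cmod (p (i + m) (j + m)) * (\<beta> (j + m) / \<beta> (i + m))"
        by (subst q_add[symmetric, of i j m]) (simp add: q_def norm_mult norm_divide less_imp_le[OF \<beta>] del: of_real_divide)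
      ultimately have "cmod (q i j) \<le> K * w k" by simp
      also have "\<dots> \<le> \<epsilon>" using k K(1) by (simp add: field_simps)
      finally show ?thesis by simp
    qed
    then have "cmod (q i j) \<le> 0" by (rule field_le_epsilon)
    then show ?thesis by simp
  qed
  define c where "c n = q (int n) 0" for n
  have p_c: "p i j = (if i < j then 0 else c (nat (i - j)) * of_real (\<beta> i / \<beta> j))" for i j
  proof -
    have "p i j = q i j * of_real (\<beta> i / \<beta> j)" using \<beta>[of i] \<beta>[of j] by (simp add: q_def)
    moreover have "q i j = q (i - j) 0" using q_add[of "i - j" j 0] by simp
    ultimately show ?thesis by (auto simp: c_def q_upper)
  qed
  \<comment> \<open>Column 0 of the identity P P = P. Triangularity cuts the sum over all integers
    down to the indices from 0 to \<open>n\<close>, and the \<beta> factors telescope to a common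
    one, leaving the Cauchy product of power series.\<close>
  have conv: "c n = (\<Sum>l=0..n. c l * c (n - l))" for n
  proof -
    have "(\<lambda>k. cinner (u (int n)) (cinner (v k) (P (u 0)) *\<^sub>C P (v k))) sums cinner (u (int n)) (P (P (u 0)))"
      by (rule bounded_linear.sums[OF bounded_linear_cinner_right bounded_clinear_expansion[OF v P]])
    then have sums1: "(\<lambda>k. p (int_decode k) 0 * p (int n) (int_decode k)) sums p (int n) 0"
      by (simp add: PP vu p_def cinner_scaleC_right)
    have sums2: "(\<lambda>k. p (int_decode k) 0 * p (int n) (int_decode k)) sums
        (\<Sum>k\<in>(int_encode \<circ> int) ` {0..n}. p (int_decode k) 0 * p (int n) (int_decode k))"
    proof (rule sums_finite)
      fix k assume k: "k \<notin> (int_encode \<circ> int) ` {0..n}"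
      show "p (int_decode k) 0 * p (int n) (int_decode k) = 0"
      proof (rule ccontr)
        assume "\<not> ?thesis"
        then have "0 \<le> int_decode k" "int_decode k \<le> int n"
          by (auto simp: p_c[of "int_decode k" 0] p_c[of "int n" "int_decode k"] split: if_splits)
        then have "k = (int_encode \<circ> int) (nat (int_decode k))" "nat (int_decode k) \<in> {0..n}" by auto
        then show False using k by blast
      qed
    qed simp
    have inj: "inj_on (int_encode \<circ> int) {0..n}" by (auto simp: inj_on_def int_encode_eq)
    have "p (int n) 0 = (\<Sum>l=0..n. p (int l) 0 * p (int n) (int l))"
      unfolding sums_unique2[OF sums1 sums2] by (subst sum.reindex[OF inj]) simp
    also have "\<dots> = (\<Sum>l=0..n. c l * c (n - l) * of_real (\<beta> (int n) / \<beta> 0))"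
      using \<beta> by (intro sum.cong) (auto simp: p_c nat_diff_distrib less_imp_neq[symmetric])
    also have "\<dots> = (\<Sum>l=0..n. c l * c (n - l)) * of_real (\<beta> (int n) / \<beta> 0)"
      by (rule sum_distrib_right[symmetric])
    finally show ?thesis using \<beta>[of 0] \<beta>[of "int n"] by (simp add: p_c)
  qed
  define f where "f = Abs_fps c"
  have "f * f = f" by (rule fps_ext) (simp add: fps_mult_nth f_def conv[symmetric])
  then have "f * (f - 1) = 0" by (simp add: algebra_simps)
  then have "f = 0 \<or> f = 1" by simp
  moreover have "fps_nth f n = c n" for n by (simp add: f_def)
  ultimately consider "\<And>n. c n = 0" | "\<And>n. c n = (if n = 0 then 1 else 0)"
    by (metis fps_zero_nth fps_one_nth)
  then show ?thesis
  proof cases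
    case 1
    have "P (v k) = 0" for k
      by (rule orthonormal_basis_zeroI[OF v]) (use p_c 1 in \<open>simp add: p_def vu\<close>)
    then have "P x = 0" for x
      using bounded_clinear_expansion[OF v P, of x] sums_unique2[OF sums_zero] by simp
    then show ?thesis by blast
  next
    case 2
    have "P (v k) - v k = 0" for k
    proof (rule orthonormal_basis_zeroI[OF v])
      fix i show "cinner (v i) (P (v k) - v k) = 0"
        using p_c[of "int_decode i" "int_decode k"] 2 \<beta>[of "int_decode k"]
        by (auto simp: cinner_diff_right vu orth p_def[symmetric])
    qed
    then have "P x = x" for x
      using bounded_clinear_eqI[OF v P bounded_clinear_id] by simp
    then show ?thesis by blast
  qed
qed

section \<open>Diagonalization up to an invertible left factor\<close>

lemma half_power_mult_sq: "((1/2) ^ n * a)\<^sup>2 = (1/4) ^ n * a\<^sup>2" for a :: real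
proof -
  have "((1/2::real) ^ n)\<^sup>2 = ((1/2)\<^sup>2) ^ n" by (simp only: power_mult[symmetric] mult.commute)
  then show ?thesis by (simp add: power_mult_distrib power2_eq_square)
qed

text \<open>For positive n, \<open>F n\<close> is the spectral projection of
  \<open>T\<^sup>* T\<close> for the interval from 0 to 4^-n. The adjoint disappears from the
  conclusion: <x, G x> is the squared norm of \<open>T x\<close>, and commuting with
  \<open>G\<close> becomes moving \<open>F n\<close> across the form <T x, T y>.\<close>

lemma exists_level_projections:
  fixes T :: "'a::chilbert_space \<Rightarrow> 'a" and e :: "nat \<Rightarrow> 'a"
  assumes e: "orthonormal_basis e" and T: "bounded_clinear T" and contr: "\<And>x. norm (T x) \<le> norm x"
  shows "\<exists>F. (\<forall>x. F 0 x = x) \<and> (\<forall>n. selfadjoint (F n)) \<and> (\<forall>n x. F n (F n x) = F n x) \<and>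
    (\<forall>n x. F n x = x \<longrightarrow> (norm (T x))\<^sup>2 \<le> (1/4) ^ n * (norm x)\<^sup>2) \<and>
    (\<forall>n x. F n x = 0 \<longrightarrow> (1/4) ^ n * (norm x)\<^sup>2 \<le> (norm (T x))\<^sup>2) \<and>
    (\<forall>m n x. F m (F n x) = F n (F m x)) \<and>
    (\<forall>n x y. cinner (T (F n x)) (T y) = cinner (T x) (T (F n y)))"
proof -
  obtain S where S: "bounded_clinear S" "\<And>x y. cinner (T x) y = cinner x (S y)"
    using exists_adjoint[OF e T] by blast
  define G where "G x = S (T x)" for x
  have G_cinner: "cinner x (G y) = cinner (T x) (T y)" for x y by (simp add: G_def S(2))
  have "cinner (G x) y = cinner x (G y)" for x y
    by (subst cinner_commute) (simp add: G_cinner flip: cinner_commute)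
  moreover have "bounded_clinear G" unfolding G_def by (rule bounded_clinear_compose[OF S(1) T])
  ultimately have G: "selfadjoint G" by (simp add: selfadjoint_def)
  have nG: "norm (G x) \<le> norm x" for x
  proof -
    have "norm (G x) * norm (G x) \<le> norm (T (G x)) * norm (T x)"
      using Re_cinner_le[of "T (G x)" "T x"] norm_sq_cinner[of "G x"]
      by (simp add: G_cinner power2_eq_square)
    also have "\<dots> \<le> norm (G x) * norm x" by (intro mult_mono contr) auto
    finally show ?thesis by (cases "G x = 0") auto
  qed
  \<comment> \<open>Level 0 is prescribed to be the identity, which contractivity of
    \<open>T\<close> permits, so that the differences of consecutive levels telescope from
    \<open>x\<close> itself.\<close>
  define level where "level n F \<longleftrightarrow> (n = 0 \<longrightarrow> F = (\<lambda>x. x)) \<and> selfadjoint F \<and> (\<forall>x. F (F x) = F x) \<and>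
    (\<forall>x. F x = x \<longrightarrow> (norm (T x))\<^sup>2 \<le> (1/4) ^ n * (norm x)\<^sup>2) \<and>
    (\<forall>x. F x = 0 \<longrightarrow> (1/4) ^ n * (norm x)\<^sup>2 \<le> (norm (T x))\<^sup>2) \<and>
    (\<forall>V. bounded_clinear V \<longrightarrow> (\<forall>x. V (G x) = G (V x)) \<longrightarrow> (\<forall>x. V (F x) = F (V x)))" for n F
  have "\<exists>F. level n F" for n
  proof (cases "n = 0")
    case True
    have "(norm (T x))\<^sup>2 \<le> (norm x)\<^sup>2" for x by (intro power_mono contr) simp
    then show ?thesis using True selfadjoint_id
      by (intro exI[of _ "\<lambda>x. x"]) (simp add: level_def)
  next
    case False
    have "(0::real) \<le> (1/4) ^ n" "(1/4::real) ^ n \<le> 1" by (simp_all add: power_le_one)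
    from exists_spectral_projection[OF G nG this] show ?thesis
      using False by (simp add: level_def G_cinner norm_sq_cinner[symmetric])
  qed
  then obtain F where F: "\<And>n. level n (F n)" by metis
  have F_sa: "selfadjoint (F n)" for n using F by (simp add: level_def)
  have F_comm: "V (F n x) = F n (V x)" if "bounded_clinear V" "\<And>x. V (G x) = G (V x)" for V n x
    using F[of n] that by (simp add: level_def)
  \<comment> \<open>The commutation clause is applied twice: with \<open>V = G\<close>, and then,
    now that each \<open>F n\<close> is known to commute with \<open>G\<close>, with
    \<open>V = F m\<close>.\<close>
  have GF: "G (F n x) = F n (G x)" for n x by (rule F_comm[OF selfadjointD(1)[OF G]]) simp
  have "F m (F n x) = F n (F m x)" for m n x
    by (rule F_comm[OF selfadjointD(1)[OF F_sa]]) (simp add: GF)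
  moreover have "cinner (T (F n x)) (T y) = cinner (T x) (T (F n y))" for n x y
    by (simp add: GF selfadjointD(2)[OF F_sa] flip: G_cinner)
  ultimately show ?thesis using F by (intro exI[of _ F]) (simp add: level_def)
qed

text \<open>The ranges of the \<open>Q n\<close> may have any dimension, so the basis is taken as a
  maximal orthonormal set of vectors each lying in one range. If \<open>x\<close> is orthogonal to
  it, so is every \<open>Q n x\<close>, and a nonzero one could be normalized and added. Comparison
  with \<open>e\<close> shows that the set is countable and infinite, hence indexed by the
  naturals.\<close>

lemma exists_adapted_basis:
  fixes Q :: "nat \<Rightarrow> 'a::chilbert_space \<Rightarrow> 'a" and e :: "nat \<Rightarrow> 'a"
  assumes e: "orthonormal_basis e" and Q: "\<And>n. selfadjoint (Q n)"
    and QQ: "\<And>m n x. Q m (Q n x) = (if m = n then Q n x else 0)"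
    and total: "\<And>x. (\<And>n. Q n x = 0) \<Longrightarrow> x = 0"
  shows "\<exists>v. orthonormal_basis v \<and> (\<forall>k. \<exists>n. Q n (v k) = v k)"
proof -
  define orthonormal where "orthonormal U \<longleftrightarrow> (\<forall>a\<in>U. \<forall>b\<in>U. cinner a b = (if a = b then 1 else 0))"
    for U :: "'a set"
  define \<S> where "\<S> = {U. orthonormal U \<and> (\<forall>a\<in>U. \<exists>n. Q n a = a)}"
  have "\<exists>U\<in>\<S>. \<forall>X\<in>\<S>. U \<subseteq> X \<longrightarrow> X = U"
  proof (rule subset_Zorn')
    fix \<C> assume chain: "subset.chain \<S> \<C>"
    have sub: "\<C> \<subseteq> \<S>" using chain by (simp add: subset_chain_def)
    have "cinner a b = (if a = b then 1 else 0)" if ab: "a \<in> \<Union>\<C>" "b \<in> \<Union>\<C>" for a b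
    proof -
      obtain A B where AB: "A \<in> \<C>" "B \<in> \<C>" "a \<in> A" "b \<in> B" using ab by blast
      then have "A \<subseteq> B \<or> B \<subseteq> A" using chain by (simp add: subset_chain_def)
      then obtain X where "X \<in> \<C>" "a \<in> X" "b \<in> X" using AB by blast
      then show ?thesis using sub by (auto simp: \<S>_def orthonormal_def)
    qed
    moreover have "\<exists>n. Q n a = a" if "a \<in> \<Union>\<C>" for a using that sub by (auto simp: \<S>_def)
    ultimately show "\<Union>\<C> \<in> \<S>" by (simp add: \<S>_def orthonormal_def)
  qed
  then obtain U where "U \<in> \<S>" and U_max: "\<And>X. X \<in> \<S> \<Longrightarrow> U \<subseteq> X \<Longrightarrow> X = U" by blast
  then have U: "cinner a b = (if a = b then 1 else 0)" if "a \<in> U" "b \<in> U" for a b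
    using that by (auto simp: \<S>_def orthonormal_def)
  have U_Q: "\<exists>n. Q n a = a" if "a \<in> U" for a using that \<open>U \<in> \<S>\<close> by (simp add: \<S>_def)
  have U_total: "x = 0" if x: "\<And>a. a \<in> U \<Longrightarrow> cinner a x = 0" for x
  proof (rule total)
    fix n
    \<comment> \<open>Each \<open>a\<close> lies in a single range, so \<open>Q n a\<close> is
      \<open>a\<close> or 0, and \<open>Q n\<close> can be moved from \<open>x\<close> to
      \<open>a\<close>.\<close>
    have perp: "cinner a (Q n x) = 0" if a: "a \<in> U" for a
    proof -
      obtain m where m: "Q m a = a" using U_Q a by blast
      have "Q n a = (if n = m then a else 0)" using QQ[of n m a] m by simp
      then show ?thesis using x[OF a] selfadjointD(2)[OF Q, of n a x] by (simp split: if_splits)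
    qed
    show "Q n x = 0"
    proof (rule ccontr)
      assume nz: "Q n x \<noteq> 0"
      define z where "z = (1 / norm (Q n x)) *\<^sub>R Q n x"
      have zz: "cinner z z = 1"
        using nz by (simp add: z_def cinner_self power2_eq_square)
      have az: "cinner a z = 0" "cinner z a = 0" if "a \<in> U" for a
        using perp[OF that] cinner_orth_commute[OF perp[OF that]]
        by (simp_all add: z_def cinner_scaleR_right cinner_scaleR_left)
      have "Q n z = z" by (simp add: z_def bounded_clinearD(6)[OF selfadjointD(1)[OF Q]] QQ)
      moreover have "z \<notin> U" using az(1)[of z] zz by auto
      ultimately have "insert z U \<in> \<S>" using U U_Q zz az by (auto simp: \<S>_def orthonormal_def)
      then show False using U_max[of "insert z U"] \<open>z \<notin> U\<close> by blast
    qed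
  qed
  have norm_U: "norm a = 1" if "a \<in> U" for a using U[OF that that] by (simp add: norm_eq_1I)
  have norm_e: "norm (e k) = 1" for k by (simp add: norm_eq_1I orthonormal_basisD[OF e])
  have Bessel_U: "(\<Sum>a\<in>S. (cmod (cinner a x))\<^sup>2) \<le> (norm x)\<^sup>2" if "finite S" "S \<subseteq> U" for S x
    using Bessel_inequality[of S "\<lambda>a. a" x] that U by (simp add: subset_iff)
  have "countable U"
  proof (rule countable_subset)
    \<comment> \<open>By Bessel, the unit vector \<open>e k\<close> can have squared coefficient
      above 1 / (m + 1) with at most \<open>m\<close> members of \<open>U\<close>.\<close>
    define L where "L k m = {a \<in> U. 1 / (real m + 1) < (cmod (cinner a (e k)))\<^sup>2}" for k m
    show "U \<subseteq> (\<Union>k. \<Union>m. L k m)"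
    proof
      fix a assume a: "a \<in> U"
      then have "a \<noteq> 0" using norm_U by fastforce
      then obtain k where "cinner (e k) a \<noteq> 0" using orthonormal_basis_zeroI[OF e] by blast
      then have "0 < (cmod (cinner a (e k)))\<^sup>2" using cinner_orth_commute[of a "e k"] by auto
      then obtain m where "1 / (real m + 1) < (cmod (cinner a (e k)))\<^sup>2"
        by (metis add.commute nat_approx_posE of_nat_Suc)
      then show "a \<in> (\<Union>k. \<Union>m. L k m)" using a by (auto simp: L_def)
    qed
    have "finite (L k m)" for k m
    proof (rule ccontr)
      assume "infinite (L k m)"
      then obtain S where S: "finite S" "card S = m + 1" "S \<subseteq> L k m"
        by (meson infinite_arbitrarily_large)
      have "1 = (\<Sum>a\<in>S. 1 / (real m + 1))" by (simp add: S(2))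
      also have "\<dots> < (\<Sum>a\<in>S. (cmod (cinner a (e k)))\<^sup>2)"
        using S by (intro sum_strict_mono) (auto simp: L_def)
      also have "\<dots> \<le> 1" using Bessel_U[of S "e k"] S by (auto simp: L_def norm_e)
      finally show False by simp
    qed
    then show "countable (\<Union>k. \<Union>m. L k m)" by (simp add: countable_finite)
  qed
  moreover have "infinite U"
  proof
    assume fin: "finite U"
    have "x = (\<Sum>a\<in>U. cinner a x *\<^sub>C a)" for x
    proof -
      have "x - (\<Sum>a\<in>U. cinner a x *\<^sub>C a) = 0"
      proof (rule U_total)
        fix b assume b: "b \<in> U"
        have "cinner b (\<Sum>a\<in>U. cinner a x *\<^sub>C a) = (\<Sum>a\<in>U. if a = b then cinner b x else 0)"
          unfolding cinner_sum_right using b U by (intro sum.cong) (auto simp: cinner_scaleC_right)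
        also have "\<dots> = cinner b x" using fin b by simp
        finally show "cinner b (x - (\<Sum>a\<in>U. cinner a x *\<^sub>C a)) = 0" by (simp add: cinner_diff_right)
      qed
      then show ?thesis by simp
    qed
    moreover have "(norm (\<Sum>a\<in>U. cinner a x *\<^sub>C a))\<^sup>2 = (\<Sum>a\<in>U. (cmod (cinner a x))\<^sup>2)" for x
      using fin by (subst norm_sum_orth) (auto simp: norm_scaleC norm_U U cinner_scaleC_left cinner_scaleC_right)
    ultimately have Parseval: "(norm x)\<^sup>2 = (\<Sum>a\<in>U. (cmod (cinner a x))\<^sup>2)" for x by metis
    \<comment> \<open>Dimension count by summing squared coefficients in both orders: Parseval along
      \<open>U\<close> gives one for each of the card U + 1 basis vectors, Bessel along
      \<open>e\<close> at most one for each member of \<open>U\<close>.\<close>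
    have "real (card U + 1) = (\<Sum>k<card U + 1. (norm (e k))\<^sup>2)" by (simp add: norm_e)
    also have "\<dots> = (\<Sum>a\<in>U. \<Sum>k<card U + 1. (cmod (cinner a (e k)))\<^sup>2)"
      unfolding Parseval by (rule sum.swap)
    also have "\<dots> \<le> (\<Sum>a\<in>U. 1)"
    proof (rule sum_mono)
      fix a assume "a \<in> U"
      have "(\<Sum>k<card U + 1. (cmod (cinner (e k) a))\<^sup>2) \<le> (norm a)\<^sup>2"
        by (rule Bessel_inequality) (auto simp: orthonormal_basisD[OF e])
      moreover have "cmod (cinner (e k) a) = cmod (cinner a (e k))" for k
        by (subst cinner_commute) simp
      ultimately show "(\<Sum>k<card U + 1. (cmod (cinner a (e k)))\<^sup>2) \<le> 1"
        using norm_U[OF \<open>a \<in> U\<close>] by simp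
    qed
    finally show False by simp
  qed
  ultimately have bij: "bij_betw (from_nat_into U) UNIV U" by (rule bij_betw_from_nat_into)
  have in_U: "from_nat_into U k \<in> U" for k using bij by (auto simp: bij_betw_def)
  have "orthonormal_basis (from_nat_into U)"
  proof (rule orthonormal_basisI)
    show "cinner (from_nat_into U i) (from_nat_into U j) = (if i = j then 1 else 0)" for i j
      using bij by (simp add: U in_U bij_betw_def inj_eq)
    show "x = 0" if x: "\<And>k. cinner (from_nat_into U k) x = 0" for x
    proof (rule U_total)
      fix a assume "a \<in> U"
      then obtain k where "a = from_nat_into U k" using bij unfolding bij_betw_def by blast
      then show "cinner a x = 0" using x by simp
    qed
  qed
  then show ?thesis using in_U U_Q by blast
qed

text \<open>\<open>Y\<close> is the sum of the operators 2^n T Q_n. The rescaling brings the bounds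
  on every level to 1/2 and 1, and since the images of distinct levels are orthogonal, these bounds
  pass to the sum by Pythagoras.\<close>

lemma exists_level_normalization:
  fixes T :: "'a::chilbert_space \<Rightarrow> 'a" and Q :: "nat \<Rightarrow> 'a \<Rightarrow> 'a"
  assumes T: "bounded_clinear T" and dense: "closure (range T) = UNIV"
    and Q: "\<And>n. selfadjoint (Q n)" and QQ: "\<And>m n x. Q m (Q n x) = (if m = n then Q n x else 0)"
    and sums: "\<And>x. (\<lambda>n. Q n x) sums x"
    and TQ: "\<And>m n x y. m \<noteq> n \<Longrightarrow> cinner (T (Q m x)) (T (Q n y)) = 0"
    and upper: "\<And>n x. (norm (T (Q n x)))\<^sup>2 \<le> (1/4) ^ n * (norm (Q n x))\<^sup>2"
    and lower: "\<And>n x. (1/4) ^ Suc n * (norm (Q n x))\<^sup>2 \<le> (norm (T (Q n x)))\<^sup>2"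
  shows "\<exists>Y. invertible_bounded Y \<and> (\<forall>n x. Q n x = x \<longrightarrow> T x = (1/2) ^ n *\<^sub>R Y x)"
proof -
  note Q_simps = bounded_clinearD[OF selfadjointD(1)[OF Q]]
  note T_simps = bounded_clinearD[OF T]
  define t where "t n x = 2 ^ n *\<^sub>R T (Q n x)" for n x
  have t_norm: "(norm (t n x))\<^sup>2 = 4 ^ n * (norm (T (Q n x)))\<^sup>2" for n x
    by (simp add: t_def power_mult_distrib power2_eq_square flip: power_mult_distrib)
  have t_upper: "(norm (t n x))\<^sup>2 \<le> (norm (Q n x))\<^sup>2" for n x
    using upper[where n = n and x = x] by (simp add: t_norm power_divide field_simps)
  have t_lower: "(1/4) * (norm (Q n x))\<^sup>2 \<le> (norm (t n x))\<^sup>2" for n x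
    using lower[where n = n and x = x] by (simp add: t_norm power_divide field_simps)
  have t_orth: "cinner (t m x) (t n x) = 0" if "m \<noteq> n" for m n x
    using TQ[OF that] by (simp add: t_def cinner_scaleR_left cinner_scaleR_right)
  have Q_sq: "(\<lambda>n. (norm (Q n x))\<^sup>2) sums (norm x)\<^sup>2" for x
  proof -
    have "(\<lambda>N. (norm (\<Sum>n<N. Q n x))\<^sup>2) \<longlonglongrightarrow> (norm x)\<^sup>2"
      using sums[of x] unfolding sums_def by (intro tendsto_intros)
    moreover have "(norm (\<Sum>n<N. Q n x))\<^sup>2 = (\<Sum>n<N. (norm (Q n x))\<^sup>2)" for N
      by (rule norm_sum_orth) (auto simp: selfadjointD(2)[OF Q] QQ)
    ultimately show ?thesis by (simp add: sums_def)
  qed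
  have t_summable: "summable (\<lambda>n. (norm (t n x))\<^sup>2)" for x
    by (rule summable_comparison_test'[OF sums_summable[OF Q_sq[of x]]]) (simp add: t_upper)
  note t_series = orthogonal_summable[where v = "\<lambda>n. t n x" for x, OF t_orth t_summable]
  have t_add: "t n (x + y) = t n x + t n y" for n x y
    by (simp add: t_def Q_simps(3) T_simps(3) scaleR_add_right)
  have t_scale: "t n (c *\<^sub>C x) = c *\<^sub>C t n x" for n c x
    by (simp add: t_def Q_simps(2) T_simps(2) scaleC_scaleC mult.commute flip: scaleC_of_real)
  define Y where "Y x = (\<Sum>n. t n x)" for x
  have Y_norm: "(norm (Y x))\<^sup>2 = (\<Sum>n. (norm (t n x))\<^sup>2)" for x
    unfolding Y_def by (rule t_series(2))
  have Y_upper: "norm (Y x) \<le> norm x" for x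
  proof -
    have "(norm (Y x))\<^sup>2 \<le> (norm x)\<^sup>2"
      unfolding Y_norm sums_unique[OF Q_sq[of x]]
      by (intro suminf_le t_upper t_summable sums_summable[OF Q_sq])
    then show ?thesis by (rule power2_le_imp_le) simp
  qed
  have Y_lower: "(1/2) * norm x \<le> norm (Y x)" for x
  proof -
    have "(1/4) * (norm x)\<^sup>2 \<le> (norm (Y x))\<^sup>2"
      unfolding Y_norm sums_unique[OF sums_mult[OF Q_sq[of x], of "1/4"]]
      by (intro suminf_le t_lower t_summable sums_summable[OF sums_mult[OF Q_sq]])
    then have "((1/2) * norm x)\<^sup>2 \<le> (norm (Y x))\<^sup>2" by (simp add: power_mult_distrib power2_eq_square)
    then show ?thesis by (rule power2_le_imp_le) simp
  qed
  have Y: "bounded_clinear Y"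
  proof (rule bounded_clinearI[where K = 1])
    fix x y show "Y (x + y) = Y x + Y y"
      unfolding Y_def t_add by (rule suminf_add[symmetric, OF t_series(1) t_series(1)])
  next
    fix c x show "Y (c *\<^sub>C x) = c *\<^sub>C Y x"
      unfolding Y_def t_scale by (rule bounded_linear.suminf[symmetric, OF bounded_linear_scaleC t_series(1)])
  qed (simp add: Y_upper)
  note Y_simps = bounded_clinearD[OF Y]
  have Y_Q: "T x = (1/2) ^ n *\<^sub>R Y x" if x: "Q n x = x" for n x
  proof -
    have "t m x = (if m = n then 2 ^ n *\<^sub>R T x else 0)" for m
      using QQ[of m n x] x by (auto simp: t_def T_simps)
    then have "(\<lambda>m. t m x) sums (2 ^ n *\<^sub>R T x)"
      using sums_single[of n "\<lambda>_. 2 ^ n *\<^sub>R T x"] by simp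
    then have "Y x = 2 ^ n *\<^sub>R T x" unfolding Y_def by (rule sums_unique[symmetric])
    then show ?thesis by (simp add: power_divide)
  qed
  have "T x \<in> closure (range Y)" for x
  proof -
    have "(\<lambda>N. T (\<Sum>n<N. Q n x)) \<longlonglongrightarrow> T x"
      using bounded_clinear_tendsto[OF T] sums[of x] unfolding sums_def by blast
    \<comment> \<open>On finite sums of levels the factors 2^n can be undone, so the range of
      \<open>Y\<close> contains \<open>T\<close> of all such sums and is dense along with that of
      \<open>T\<close>.\<close>
    moreover have "T (\<Sum>n<N. Q n x) = Y (\<Sum>n<N. (1/2) ^ n *\<^sub>R Q n x)" for N
      using Y_Q by (induction N) (simp_all add: T_simps Y_simps QQ)
    ultimately show ?thesis unfolding closure_sequential by (intro exI conjI allI) auto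
  qed
  then have "closure (range T) \<subseteq> closure (range Y)" by (intro closure_minimal) auto
  then have "surj Y" using dense Y_lower
    by (intro bounded_below_dense_imp_surj[OF Y, of "1/2"]) auto
  then have "invertible_bounded Y" using Y_lower by (intro invertible_boundedI[OF Y, of "1/2"]) auto
  then show ?thesis using Y_Q by blast
qed

text \<open>The levels are the spectral subspaces of \<open>T\<^sup>* T\<close> for the intervals between \<open>4\<^sup>-\<^sup>n\<^sup>-\<^sup>1\<close> and \<open>4\<^sup>-\<^sup>n\<close>:
  on the \<open>n\<close>-th one \<open>T\<close> is \<open>2\<^sup>-\<^sup>n\<close> times an almost isometric map, and \<open>T\<close> keeps distinct levels orthogonal.\<close>

lemma exists_diagonalization:
  fixes T :: "'a::chilbert_space \<Rightarrow> 'a" and e :: "nat \<Rightarrow> 'a"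
  assumes e: "orthonormal_basis e" and T: "bounded_clinear T" and contr: "\<And>x. norm (T x) \<le> norm x"
    and inj: "\<And>x. T x = 0 \<Longrightarrow> x = 0" and dense: "closure (range T) = UNIV"
    and not_below: "\<And>c. c > 0 \<Longrightarrow> \<exists>x. norm (T x) < c * norm x"
  shows "\<exists>Y v w. invertible_bounded Y \<and> orthonormal_basis v \<and> (\<forall>k. 0 < w k \<and> w k \<le> 1) \<and>
    (\<forall>\<epsilon>>0. \<exists>k. w k < \<epsilon>) \<and> (\<forall>k. T (v k) = (w k :: real) *\<^sub>R Y (v k))"
proof -
  from exists_level_projections[OF e T contr] obtain F
    where F: "\<forall>x. F 0 x = x" "\<forall>n. selfadjoint (F n)" "\<forall>n x. F n (F n x) = F n x"
      "\<forall>n x. F n x = x \<longrightarrow> (norm (T x))\<^sup>2 \<le> (1/4) ^ n * (norm x)\<^sup>2"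
      "\<forall>n x. F n x = 0 \<longrightarrow> (1/4) ^ n * (norm x)\<^sup>2 \<le> (norm (T x))\<^sup>2"
      "\<forall>m n x. F m (F n x) = F n (F m x)"
      "\<forall>n x y. cinner (T (F n x)) (T y) = cinner (T x) (T (F n y))"
    by (elim exE conjE)
  note F0 = F(1)[rule_format] and F_sa = F(2)[rule_format] and FF = F(3)[rule_format]
    and F_upper = F(4)[rule_format] and F_lower = F(5)[rule_format]
    and F_comm = F(6)[rule_format] and FT = F(7)[rule_format]
  note F_simps = bounded_clinearD[OF selfadjointD(1)[OF F_sa]]
  note T_simps = bounded_clinearD[OF T]
  have F_Suc: "F n (F (Suc n) x) = F (Suc n) x" for n x
  proof -
    \<comment> \<open>That the projections decrease is forced by their estimates: \<open>y\<close>
      is fixed by \<open>F (Suc n)\<close> and killed by \<open>F n\<close>, so 4^-n |y|^2 is at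
      most |T y|^2, which is at most 4^-(n+1) |y|^2.\<close>
    define y where "y = F (Suc n) x - F n (F (Suc n) x)"
    have "F n y = 0" by (simp add: y_def F_simps FF)
    then have "(1/4) ^ n * (norm y)\<^sup>2 \<le> (norm (T y))\<^sup>2" by (rule F_lower)
    also have "F (Suc n) y = y" by (simp add: y_def F_simps FF F_comm[of "Suc n" n])
    then have "(norm (T y))\<^sup>2 \<le> (1/4) ^ Suc n * (norm y)\<^sup>2" by (rule F_upper)
    finally have "(norm y)\<^sup>2 \<le> 0" by (simp add: power_divide field_simps)
    then show ?thesis by (simp add: y_def)
  qed
  have F_le: "F m (F n x) = F n x" if "m \<le> n" for m n x
    using that
  proof (induction n arbitrary: x rule: dec_induct)
    case (step n)
    then show ?case by (metis F_Suc)
  qed (rule FF)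
  have F_max: "F m (F n x) = F (max m n) x" for m n x
    using F_le[of m n x] F_le[of n m x] F_comm[of m n x] by (cases "m \<le> n") (simp_all add: max_def)
  define Q where "Q n x = F n x - F (Suc n) x" for n x
  have Q: "selfadjoint (Q n)" for n unfolding Q_def by (intro selfadjoint_intros F_sa)
  have QQ: "Q m (Q n x) = (if m = n then Q n x else 0)" for m n x
    by (cases m n rule: linorder_cases) (auto simp: Q_def F_simps F_max max_def le_Suc_eq)
  have F_Q: "F n (Q n x) = Q n x" "F (Suc n) (Q n x) = 0" for n x
    by (simp_all add: Q_def F_simps F_max max_def)
  have TQ: "cinner (T (Q m x)) (T (Q n y)) = 0" if "m \<noteq> n" for m n x y
  proof -
    have "cinner (T (Q m x)) (T z) = cinner (T x) (T (Q m z))" for z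
      by (simp add: Q_def T_simps cinner_diff_left cinner_diff_right FT)
    then show ?thesis using that by (simp add: QQ T_simps)
  qed
  have F_norm: "norm (F n x) \<le> norm x" for n x
  proof -
    have "norm (F n x) * norm (F n x) \<le> norm x * norm (F n x)"
      using Re_cinner_le[of x "F n x"] norm_sq_cinner[of "F n x"]
      by (simp add: selfadjointD(2)[OF F_sa] FF power2_eq_square)
    then show ?thesis by (cases "F n x = 0") auto
  qed
  have sums: "(\<lambda>n. Q n x) sums x" for x
  proof -
    have partial: "(\<Sum>n<N. Q n x) = x - F N x" for N
      unfolding Q_def by (induction N) (simp_all add: F0)
    have Q_orth: "cinner (Q m x) (Q n x) = 0" if "m \<noteq> n" for m n
      using that by (simp add: selfadjointD(2)[OF Q] QQ)
    have "(\<Sum>n<N. (norm (Q n x))\<^sup>2) \<le> (2 * norm x)\<^sup>2" for N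
    proof -
      have "(\<Sum>n<N. (norm (Q n x))\<^sup>2) = (norm (x - F N x))\<^sup>2"
        unfolding partial[symmetric] by (rule norm_sum_orth[symmetric]) (auto simp: Q_orth)
      also have "\<dots> \<le> (2 * norm x)\<^sup>2"
        using norm_triangle_ineq4[of x "F N x"] F_norm[of N x] by (intro power_mono) auto
      finally show ?thesis .
    qed
    then have "summable (\<lambda>n. (norm (Q n x))\<^sup>2)"
      by (intro bounded_imp_summable[of _ "(2 * norm x)\<^sup>2"]) (simp_all only: lessThan_Suc_atMost[symmetric] zero_le_power2)
    from orthogonal_summable(1)[OF Q_orth this] obtain s where s: "(\<lambda>n. Q n x) sums s"
      by (auto simp: summable_def)
    then have "(\<lambda>N. x - (x - F N x)) \<longlonglongrightarrow> x - s"
      unfolding sums_def partial by (intro tendsto_intros)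
    then have lim: "(\<lambda>N. F N x) \<longlonglongrightarrow> x - s" by simp
    \<comment> \<open>Orthogonality alone makes \<open>F N x\<close> converge, to x - s. The limit
      is 0 because \<open>T\<close> shrinks the range of \<open>F N\<close> by 2^-N and is
      injective.\<close>
    have "(\<lambda>N. T (F N x)) \<longlonglongrightarrow> 0"
    proof (rule Lim_null_comparison)
      have "norm (T (F N x)) \<le> (1/2) ^ N * norm x" for N
      proof -
        have "(norm (T (F N x)))\<^sup>2 \<le> (1/4) ^ N * (norm (F N x))\<^sup>2" by (rule F_upper[OF FF])
        also have "\<dots> \<le> (1/4) ^ N * (norm x)\<^sup>2" by (intro mult_left_mono power_mono F_norm) auto
        also have "\<dots> = ((1/2) ^ N * norm x)\<^sup>2"
          by (rule half_power_mult_sq[symmetric])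
        finally show ?thesis by (rule power2_le_imp_le) simp
      qed
      then show "\<forall>\<^sub>F N in sequentially. norm (T (F N x)) \<le> (1/2) ^ N * norm x" by simp
      show "(\<lambda>N. (1/2) ^ N * norm x) \<longlonglongrightarrow> 0"
        by (intro tendsto_mult_left_zero LIMSEQ_power_zero) simp
    qed
    then have "T (x - s) = 0" using bounded_clinear_tendsto[OF T lim] LIMSEQ_unique by blast
    then have "x = s" using inj by fastforce
    then show ?thesis using s by simp
  qed
  have total: "x = 0" if "\<And>n. Q n x = 0" for x using sums[of x] that sums_unique2[OF sums_zero] by simp
  obtain v where v: "orthonormal_basis v" and Qv: "\<And>k. \<exists>n. Q n (v k) = v k"
    using exists_adapted_basis[OF e Q QQ total] by blast
  obtain Y where Y: "invertible_bounded Y" and TY: "\<And>n x. Q n x = x \<Longrightarrow> T x = (1/2) ^ n *\<^sub>R Y x"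
    using exists_level_normalization[OF T dense Q QQ sums TQ F_upper[OF F_Q(1)] F_lower[OF F_Q(2)]] by blast
  obtain l where l: "\<And>k. Q (l k) (v k) = v k" using Qv by metis
  have "\<exists>k. (1/2) ^ l k < \<epsilon>" if "\<epsilon> > 0" for \<epsilon> :: real
  proof -
    obtain n where n: "(1/2) ^ n < \<epsilon>" using real_arch_pow_inv[of \<epsilon> "1/2"] \<open>\<epsilon> > 0\<close> by auto
    obtain x where x: "norm (T x) < (1/2) ^ n * norm x" using not_below[of "(1/2) ^ n"] by auto
    \<comment> \<open>If \<open>F n\<close> killed the whole basis, \<open>T\<close> would be
      bounded below by 2^-n. A \<open>v k\<close> not killed must lie at level \<open>n\<close> or
      deeper, so its weight is at most 2^-n.\<close>
    have "\<exists>k. F n (v k) \<noteq> 0"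
    proof (rule ccontr)
      assume "\<not> ?thesis"
      then have "F n x = 0"
        using bounded_clinear_expansion[OF v selfadjointD(1)[OF F_sa[of n]], of x] sums_unique2[OF sums_zero] by simp
      from F_lower[OF this] have "((1/2) ^ n * norm x)\<^sup>2 \<le> (norm (T x))\<^sup>2"
        by (simp only: half_power_mult_sq)
      then show False using power2_le_imp_le[of "(1/2) ^ n * norm x" "norm (T x)"] x by simp
    qed
    then obtain k where k: "F n (v k) \<noteq> 0" by blast
    have "n \<le> l k"
    proof (rule ccontr)
      assume "\<not> n \<le> l k"
      then have "F n (Q (l k) (v k)) = 0" by (auto simp: Q_def F_simps F_max max_def le_Suc_eq)
      then show False using k l by simp
    qed
    then have "(1/2::real) ^ l k \<le> (1/2) ^ n" by (intro power_decreasing) auto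
    then have "(1/2) ^ l k < \<epsilon>" using n by (rule le_less_trans)
    then show ?thesis by blast
  qed
  then show ?thesis using Y v TY[OF l]
    by (intro exI[of _ Y] exI[of _ v] exI[of _ "\<lambda>k. (1/2) ^ l k"]) (auto simp: power_le_one)
qed

section \<open>Strong irreducibility in the left orbit\<close>

lemma strongly_irreducibleI_commutant:
  assumes "bounded_clinear A"
    and "\<And>P. bounded_clinear P \<Longrightarrow> (\<And>x. P (P x) = P x) \<Longrightarrow> (\<And>x. P (A x) = A (P x)) \<Longrightarrow>
      (\<forall>x. P x = 0) \<or> (\<forall>x. P x = x)"
  shows "strongly_irreducible A"
  unfolding strongly_irreducible_def fun_eq_iff comp_def id_def using assms by blast

lemma invertible_boundedE:
  assumes "invertible_bounded X"
  obtains Y where "invertible_bounded Y" "\<And>x. X (Y x) = x" "\<And>x. Y (X x) = x"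
  using assms unfolding invertible_bounded_def fun_eq_iff comp_def id_def by metis

lemma invertible_bounded_scaleR:
  assumes "r \<noteq> 0" shows "invertible_bounded (\<lambda>x::'a::complex_inner. r *\<^sub>R x)"
  unfolding invertible_bounded_def using assms
  by (intro conjI exI[of _ "\<lambda>x. inverse r *\<^sub>R x"] bounded_clinear_scaleR bounded_clinear_id)
    (auto simp: fun_eq_iff)

lemma shift_index_inj: "inj (\<lambda>k. int_encode (int_decode k + 1))"
  by (auto simp: inj_def int_encode_eq int_decode_eq)

text \<open>When \<open>T\<close> is invertible, every invertible operator lies in its orbit; adding a scalar to a
  non-invertible bilateral shift makes it invertible without changing its commutant.\<close>

lemma exists_invertible_strongly_irreducible:
  fixes e :: "nat \<Rightarrow> 'a::chilbert_space"
  assumes e: "orthonormal_basis e"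
  shows "\<exists>A :: 'a \<Rightarrow> 'a. invertible_bounded A \<and> strongly_irreducible A"
proof -
  define w :: "int \<Rightarrow> real" where "w j = (1/2) ^ nat \<bar>j\<bar>" for j
  have w: "0 < w j" "w j \<le> 1" for j by (simp_all add: w_def power_le_one)
  have w_inf: "\<exists>j. w j < \<epsilon>" if "\<epsilon> > 0" for \<epsilon>
  proof -
    obtain n where "(1/2) ^ n < \<epsilon>" using real_arch_pow_inv[of \<epsilon> "1/2"] \<open>\<epsilon> > 0\<close> by auto
    then show ?thesis by (intro exI[of _ "int n"]) (simp add: w_def)
  qed
  obtain B :: "'a \<Rightarrow> 'a" where B: "bounded_clinear B" and nB: "\<And>x. norm (B x) \<le> norm x"
    and B_e: "\<And>k. B (e k) = of_real (w (int_decode k)) *\<^sub>C e (int_encode (int_decode k + 1))"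
    using exists_weighted_permutation[OF e shift_index_inj, of "\<lambda>k. of_real (w (int_decode k))"] w
    by (auto simp: less_imp_le)
  note B_simps = bounded_clinearD[OF B]
  \<comment> \<open>With \<open>B\<close> of norm at most 1, the scalar 2 yields the lower bound 1
    and the contraction factor 1/2 used for surjectivity.\<close>
  define A where "A x = 2 *\<^sub>R x + B x" for x
  have A: "bounded_clinear A" unfolding A_def by (rule bounded_clinear_add[OF bounded_clinear_scaleR[OF bounded_clinear_id] B])
  have lower: "1 * norm x \<le> norm (A x)" for x
  proof -
    have "A x - B x = 2 *\<^sub>R x" by (simp add: A_def)
    then have "2 * norm x \<le> norm (A x) + norm (B x)"
      using norm_triangle_ineq4[of "A x" "B x"] by simp
    then show ?thesis using nB[of x] by linarith
  qed
  have "z \<in> range A" for z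
  proof -
    \<comment> \<open>Fixed points of \<open>g\<close> are exactly the solutions of
      \<open>A y = z\<close>.\<close>
    define g where "g y = (1/2) *\<^sub>R (z - B y)" for y
    have "dist (g x) (g y) \<le> (1/2) * dist x y" for x y
    proof -
      have "g x - g y = (1/2) *\<^sub>R B (y - x)" by (simp add: g_def B_simps scaleR_diff_right)
      then show ?thesis using nB[of "y - x"] by (simp add: dist_norm norm_minus_commute)
    qed
    then obtain y where "g y = y"
      using banach_fix_type[of "1/2" g] by auto
    moreover have "2 *\<^sub>R g y = z - B y" by (simp add: g_def)
    ultimately have "2 *\<^sub>R y = z - B y" by simp
    then have "A y = z" by (simp add: A_def)
    then show ?thesis by blast
  qed
  then have "surj A" by blast
  then have "invertible_bounded A" using lower by (intro invertible_boundedI[OF A, of 1]) auto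
  moreover have "strongly_irreducible A"
  proof (rule strongly_irreducibleI_commutant[OF A])
    fix P assume P: "bounded_clinear P" "\<And>x. P (P x) = P x" and comm: "\<And>x. P (A x) = A (P x)"
    have "P (B x) = B (P x)" for x
      using comm[of x] by (simp add: A_def bounded_clinearD[OF P(1)])
    then show "(\<forall>x. P x = 0) \<or> (\<forall>x. P x = x)"
      using B_e by (intro bilateral_shift_commutant[OF e w w_inf B _ P]) auto
  qed
  ultimately show ?thesis by blast
qed

lemma exists_strongly_irreducible_left_multiple_contraction:
  fixes T :: "'a::chilbert_space \<Rightarrow> 'a" and e :: "nat \<Rightarrow> 'a"
  assumes e: "orthonormal_basis e" and T: "bounded_clinear T" and contr: "\<And>x. norm (T x) \<le> norm x"
    and inj: "\<And>x. T x = 0 \<Longrightarrow> x = 0" and dense: "closure (range T) = UNIV"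
  shows "\<exists>X. invertible_bounded X \<and> strongly_irreducible (\<lambda>x. X (T x))"
proof (cases "\<exists>c>0. \<forall>x. c * norm x \<le> norm (T x)")
  case True
  then obtain c where c: "c > 0" "\<And>x. c * norm x \<le> norm (T x)" by blast
  have "invertible_bounded T"
    by (rule invertible_boundedI[OF T c bounded_below_dense_imp_surj[OF T c dense]])
  then obtain T' where T': "invertible_bounded T'" "\<And>x. T' (T x) = x" by (metis invertible_boundedE)
  obtain A :: "'a \<Rightarrow> 'a" where A: "invertible_bounded A" "strongly_irreducible A"
    using exists_invertible_strongly_irreducible[OF e] by blast
  then show ?thesis
    using invertible_bounded_compose[OF A(1) T'(1)] T'(2) by (intro exI[of _ "\<lambda>x. A (T' x)"]) simp
next
  case False
  then have "\<exists>x. norm (T x) < c * norm x" if "c > 0" for c using that by (meson not_le)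
  from exists_diagonalization[OF e T contr inj dense this] obtain Y v w
    where Y: "invertible_bounded Y" and v: "orthonormal_basis v"
      and w': "\<forall>k. 0 < w k \<and> w k \<le> 1" and w_inf: "\<forall>\<epsilon>>0. \<exists>k. w k < \<epsilon>"
      and T_v: "\<forall>k. T (v k) = (w k :: real) *\<^sub>R Y (v k)"
    by blast
  have w: "0 < w k" "w k \<le> 1" for k using w' by auto
  obtain Y' where Y': "invertible_bounded Y'" "\<And>x. Y' (Y x) = x" using Y by (metis invertible_boundedE)
  obtain B :: "'a \<Rightarrow> 'a" where B: "bounded_clinear B"
    and B_v: "\<And>k. B (v k) = v (int_encode (int_decode k + 1))"
    using exists_weighted_permutation[OF v shift_index_inj, of "\<lambda>_. 1"] by auto
  have "inj (\<lambda>k. int_encode (int_decode k - 1))"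
    by (auto simp: inj_def int_encode_eq int_decode_eq)
  from exists_weighted_permutation[OF v this, of "\<lambda>_. 1"] obtain B' :: "'a \<Rightarrow> 'a" where B': "bounded_clinear B'"
    and B'_v: "\<And>k. B' (v k) = v (int_encode (int_decode k - 1))"
    by auto
  have "B (B' x) = x" "B' (B x) = x" for x
    using bounded_clinear_eqI[OF v bounded_clinear_compose[OF B B'] bounded_clinear_id]
      bounded_clinear_eqI[OF v bounded_clinear_compose[OF B' B] bounded_clinear_id]
    by (simp_all add: B_v B'_v)
  then have B_inv: "invertible_bounded B"
    unfolding invertible_bounded_def using B B' by (auto simp: fun_eq_iff)
  have Y'_bc: "bounded_clinear Y'" using Y'(1) by (simp add: invertible_bounded_def)
  \<comment> \<open>\<open>Y'\<close> alone would make the product diagonal along \<open>v\<close>,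
    commuting with all coordinate projections; \<open>B\<close> turns it into a weighted
    shift.\<close>
  define X where "X x = B (Y' x)" for x
  have X: "invertible_bounded X" unfolding X_def by (rule invertible_bounded_compose[OF B_inv Y'(1)])
  have XT: "bounded_clinear (\<lambda>x. X (T x))"
    unfolding X_def by (rule bounded_clinear_compose[OF B bounded_clinear_compose[OF Y'_bc T]])
  have "\<exists>j. w (int_encode j) < \<epsilon>" if "\<epsilon> > 0" for \<epsilon>
    using w_inf that by (metis int_decode_inverse)
  moreover have "X (T (v (int_encode j))) = of_real (w (int_encode j)) *\<^sub>C v (int_encode (j + 1))" for j
    by (simp add: X_def T_v bounded_clinearD(6)[OF Y'_bc] bounded_clinearD(6)[OF B] Y'(2) B_v scaleC_of_real)
  ultimately have "strongly_irreducible (\<lambda>x. X (T x))"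
    by (intro strongly_irreducibleI_commutant[OF XT]
        bilateral_shift_commutant[OF v, where w = "\<lambda>j. w (int_encode j)"
          and A = "\<lambda>x. X (T x)"] w XT) auto
  then show ?thesis using X by blast
qed

text \<open>Normalizes \<open>T\<close> to a contraction; the scalar is absorbed into the invertible
  left factor.\<close>

lemma exists_strongly_irreducible_left_multiple:
  fixes T :: "'a::chilbert_space \<Rightarrow> 'a" and e :: "nat \<Rightarrow> 'a"
  assumes e: "orthonormal_basis e" and T: "bounded_clinear T"
    and inj: "\<And>x. T x = 0 \<Longrightarrow> x = 0" and dense: "closure (range T) = UNIV"
  shows "\<exists>X. invertible_bounded X \<and> strongly_irreducible (\<lambda>x. X (T x))"
proof -
  obtain K where K: "K > 0" "\<And>x. norm (T x) \<le> K * norm x" using bounded_clinear_bound[OF T] by metis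
  define T' where "T' x = inverse K *\<^sub>R T x" for x
  have T': "bounded_clinear T'" unfolding T'_def by (intro bounded_clinear_scaleR T)
  have contr: "norm (T' x) \<le> norm x" for x using K(2)[of x] K(1) by (simp add: T'_def field_simps)
  have inj': "x = 0" if "T' x = 0" for x using that K(1) inj by (simp add: T'_def)
  have "T x = T' (K *\<^sub>R x)" for x using K(1) by (simp add: T'_def bounded_clinearD(6)[OF T])
  then have "range T \<subseteq> range T'" by auto
  then have "closure (range T') = UNIV" using dense closure_mono by blast
  from exists_strongly_irreducible_left_multiple_contraction[OF e T' contr inj' this]
  obtain X where X: "invertible_bounded X" "strongly_irreducible (\<lambda>x. X (T' x))" by blast
  have "invertible_bounded (\<lambda>x. X (inverse K *\<^sub>R x))"
    using K(1) by (intro invertible_bounded_compose[OF X(1)] invertible_bounded_scaleR) simp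
  then show ?thesis using X(2) unfolding T'_def by blast
qed

theorem corollary3p5:
  fixes e \<psi> :: "nat \<Rightarrow> 'a::chilbert_space"
  assumes "orthonormal_basis e"
    and "schauder_basis \<psi>"
    and "represents_bounded_operator e \<psi>"
  shows "\<exists>A. strongly_irreducible A \<and> operator_matrix e A \<in> gl_orbit e (schauder_matrix e \<psi>)"
proof -
  note e = assms(1)
  obtain T where T: "bounded_clinear T" and T_e: "\<And>n. T (e n) = \<psi> n"
    using assms(3) unfolding represents_bounded_operator_def by blast
  note T_simps = bounded_clinearD[OF T]
  \<comment> \<open>Uniqueness of the expansion of 0: if \<open>T x = 0\<close>, the coordinates of
    \<open>x\<close> are coefficients of an expansion of 0 along \<psi>.\<close>
  have inj: "x = 0" if "T x = 0" for x
  proof (rule orthonormal_basis_zeroI[OF e])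
    have sums_x: "(\<lambda>n. cinner (e n) x *\<^sub>C \<psi> n) sums 0"
      using bounded_clinear_expansion[OF e T, of x] that by (simp add: T_e)
    have sums_0: "(\<lambda>n. 0 *\<^sub>C \<psi> n) sums 0" by simp
    have "\<exists>!\<alpha>. (\<lambda>n. \<alpha> n *\<^sub>C \<psi> n) sums 0"
      using assms(2) by (simp add: schauder_basis_def)
    then have unique: "\<alpha> = \<beta>" if "(\<lambda>n. \<alpha> n *\<^sub>C \<psi> n) sums 0" "(\<lambda>n. \<beta> n *\<^sub>C \<psi> n) sums 0" for \<alpha> \<beta>
      using that by blast
    have "(\<lambda>n. cinner (e n) x) = (\<lambda>n. 0)" by (rule unique[OF sums_x sums_0])
    then show "cinner (e k) x = 0" for k by (simp add: fun_eq_iff)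
  qed
  \<comment> \<open>Existence of expansions: the partial sums are values of
    \<open>T\<close>.\<close>
  have "x \<in> closure (range T)" for x
  proof -
    obtain \<alpha> where "(\<lambda>n. \<alpha> n *\<^sub>C \<psi> n) sums x" using assms(2) unfolding schauder_basis_def by (meson ex1_implies_ex)
    moreover have "(\<Sum>n<N. \<alpha> n *\<^sub>C \<psi> n) = T (\<Sum>n<N. \<alpha> n *\<^sub>C e n)" for N
      by (induction N) (simp_all add: T_simps T_e)
    ultimately show ?thesis unfolding sums_def closure_sequential by (intro exI conjI allI) auto
  qed
  then have "closure (range T) = UNIV" by blast
  from exists_strongly_irreducible_left_multiple[OF e T inj this]
  obtain X where X: "invertible_bounded X" and XT: "strongly_irreducible (\<lambda>x. X (T x))" by blast
  have X_bc: "bounded_clinear X" using X by (simp add: invertible_bounded_def)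
  \<comment> \<open>The entries of the matrix product are convergent series, obtained by applying
    \<open>X\<close> to the expansion of \<open>\<psi> n\<close> along \<open>e\<close>, so
    \<open>suminf\<close> takes its true value.\<close>
  have "cinner (e k) (X (T (e n))) = (\<Sum>j. cinner (e k) (X (e j)) * cinner (e j) (\<psi> n))" for k n
  proof -
    have "(\<lambda>j. cinner (e k) (cinner (e j) (\<psi> n) *\<^sub>C X (e j))) sums cinner (e k) (X (\<psi> n))"
      by (rule bounded_linear.sums[OF bounded_linear_cinner_right bounded_clinear_expansion[OF e X_bc]])
    then show ?thesis by (simp add: T_e cinner_scaleC_right mult.commute sums_unique)
  qed
  then have "operator_matrix e (\<lambda>x. X (T x)) = matrix_product (operator_matrix e X) (schauder_matrix e \<psi>)"
    by (simp add: operator_matrix_def matrix_product_def schauder_matrix_def)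
  then show ?thesis using XT X unfolding gl_orbit_def by blast
qed

end
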